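(* Let $0<p\le1$, let $V$ be a complex Banach space, let $\mathrm{End}(V)$ be the Banach algebra of bounded linear operators on $V$ with the operator norm, let $T\in\mathrm{End}(V)$, and let $f(z)=\sum_{n=0}^\infty a_nz^n$ be an entire function. Let $S=\mathbb{N}\cup\{\infty\}$, let $\varphi_{T,f}:S\to\mathrm{End}(V)$ be the map $n\mapsto\sqrt{a_n}\cdot T^n$, $\infty\mapsto0$, and let $\widetilde{\varphi_{T,f}}:\mathcal{M}_{<p}(S)\to\mathrm{End}(V)$ be its unique extension to a map of condensed $\mathbb{C}$-vector spaces. Let $\mu_f\in\mathcal{M}_{<p}(S)$ be the measure with mass $\sqrt{a_n}$ at $n\in\mathbb{N}$ and mass $0$ at $\infty$. Then $$\widetilde{\varphi_{T,f}}(\mu_f)=f(T),$$ where the right-hand side denotes the operator given by the sum $\sum_{i=0}^\infty a_iT^i$, convergent in the operator norm.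
   Context: $\sqrt{a_n}$ denotes a chosen complex square root of $a_n$ (the same choice in $\varphi_{T,f}$ and $\mu_f$). $S=\mathbb{N}\cup\{\infty\}$ is the one-point compactification of the discrete set $\mathbb{N}$, a profinite set. Fix an uncountable strong limit cardinal $\kappa$. A condensed set is a sheaf of sets on the site of $\kappa$-small profinite sets with covers the finite jointly surjective families; a topological space $X$ gives the condensed set $\underline{X}:T\mapsto\mathrm{Cont}(T,X)$, and topological vector spaces such as Banach spaces are viewed as condensed $\mathbb{C}$-vector spaces (modules over $\underline{\mathbb{C}}$ in condensed abelian groups) this way. For a finite set $T$, $q\in(0,1]$ and $c>0$, $\mathbb{C}[T]_{\ell^q\le c}=\{(x_t)\in\mathbb{C}[T]:\sum_t|x_t|^q\le c\}$; for a profinite set $T=\varprojlim_iT_i$ with $T_i$ finite, $\mathcal{M}_q(T)=\bigcup_{c>0}\varprojlim_i\mathbb{C}[T_i]_{\ell^q\le c}$ (each limit a compact Hausdorff space viewed as a condensed set, with push-forward transition maps) and $\mathcal{M}_{<p}(T)=\bigcup_{q<p}\mathcal{M}_q(T)$, a condensed $\mathbb{C}$-vector space. There is a map $T\to\mathcal{M}_{<p}(T)$ sending a point to its Dirac measure. Banach spaces $W$ are $p$-liquid: every map of condensed sets $T\to W$ from a profinite set $T$ extends uniquely along $T\to\mathcal{M}_{<p}(T)$ to a map of condensed $\mathbb{C}$-vector spaces $\mathcal{M}_{<p}(T)\to W$. *)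

theory Defs
  imports "HOL-Analysis.Analysis" "HOL-Algebra.Module"
begin

section \<open>Complex Banach spaces and the Banach algebra of endomorphisms\<close>

class complex_banach = banach +
  fixes scaleC :: "complex \<Rightarrow> 'a \<Rightarrow> 'a"  (infixr \<open>*\<^sub>C\<close> 75)
  assumes scaleC_add_right: "c *\<^sub>C (x + y) = c *\<^sub>C x + c *\<^sub>C y"
    and scaleC_add_left: "(c + d) *\<^sub>C x = c *\<^sub>C x + d *\<^sub>C x"
    and scaleC_scaleC: "c *\<^sub>C d *\<^sub>C x = (c * d) *\<^sub>C x"
    and scaleC_of_real: "complex_of_real r *\<^sub>C x = r *\<^sub>R x"
    and norm_scaleC: "norm (c *\<^sub>C x) = cmod c * norm x"

lemma scaleC_one: "1 *\<^sub>C x = (x :: 'a::complex_banach)"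
  using scaleC_of_real[of 1 x] by simp

lemma scaleC_minus_right: "c *\<^sub>C (- x) = - (c *\<^sub>C (x :: 'a::complex_banach))"
proof -
  have "- x = complex_of_real (- 1) *\<^sub>C x" "- (c *\<^sub>C x) = complex_of_real (- 1) *\<^sub>C c *\<^sub>C x"
    unfolding scaleC_of_real by simp_all
  then show ?thesis
    by (simp add: scaleC_scaleC mult.commute)
qed

lemma scaleC_zero_right: "c *\<^sub>C 0 = (0 :: 'a::complex_banach)"
  using norm_scaleC[of c "0::'a"] by simp

lemma scaleC_diff_right: "c *\<^sub>C (x - y) = c *\<^sub>C x - c *\<^sub>C (y :: 'a::complex_banach)"
  using scaleC_add_right[of c x "- y"] by (simp add: scaleC_minus_right)

lemma scaleC_scaleR_commute: "c *\<^sub>C (r *\<^sub>R x) = r *\<^sub>R (c *\<^sub>C (x :: 'a::complex_banach))"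
  by (simp flip: scaleC_of_real add: scaleC_scaleC mult.commute)

lemma bounded_linear_scaleC: "bounded_linear (\<lambda>x::'a::complex_banach. c *\<^sub>C x)"
  by (rule bounded_linear_intro[where K = "cmod c"])
    (simp_all add: scaleC_add_right scaleC_scaleR_commute norm_scaleC mult.commute)

text \<open>An element of \<open>'v \<Rightarrow>\<^sub>L 'v\<close> is a bounded \<open>\<real>\<close>-linear map, whose norm is the operator norm.\<close>

typedef (overloaded) ('v::complex_banach) endo =
  "{A :: 'v \<Rightarrow>\<^sub>L 'v. \<forall>c x. blinfun_apply A (c *\<^sub>C x) = c *\<^sub>C blinfun_apply A x}"
  by (rule exI[of _ 0]) (simp add: scaleC_zero_right)

setup_lifting type_definition_endo

lemma closed_endo_carrier:
  "closed {A :: 'v::complex_banach \<Rightarrow>\<^sub>L 'v. \<forall>c x. blinfun_apply A (c *\<^sub>C x) = c *\<^sub>C blinfun_apply A x}"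
proof -
  have "closed {A :: 'v \<Rightarrow>\<^sub>L 'v. blinfun_apply A (c *\<^sub>C x) = c *\<^sub>C blinfun_apply A x}" for c x
    by (intro closed_Collect_eq continuous_intros
        bounded_linear.continuous_on[OF bounded_linear_scaleC])
  then show ?thesis
    unfolding Collect_all_eq by (intro closed_INT ballI)
qed

instantiation endo :: (complex_banach) "{real_normed_algebra, monoid_mult}"
begin

lift_definition zero_endo :: "'a endo" is 0 by (simp add: scaleC_zero_right)

lift_definition one_endo :: "'a endo" is id_blinfun by simp

lift_definition plus_endo :: "'a endo \<Rightarrow> 'a endo \<Rightarrow> 'a endo" is "(+)"
  by (simp add: blinfun.add_left scaleC_add_right)

lift_definition uminus_endo :: "'a endo \<Rightarrow> 'a endo" is uminus
  by (simp add: blinfun.minus_left scaleC_minus_right)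

lift_definition minus_endo :: "'a endo \<Rightarrow> 'a endo \<Rightarrow> 'a endo" is "(-)"
  by (simp add: blinfun.diff_left scaleC_diff_right)

lift_definition times_endo :: "'a endo \<Rightarrow> 'a endo \<Rightarrow> 'a endo" is "(o\<^sub>L)"
  by simp

lift_definition scaleR_endo :: "real \<Rightarrow> 'a endo \<Rightarrow> 'a endo" is "(*\<^sub>R)"
  by (simp add: blinfun.scaleR_left scaleC_scaleR_commute)

lift_definition norm_endo :: "'a endo \<Rightarrow> real" is norm .

definition dist_endo :: "'a endo \<Rightarrow> 'a endo \<Rightarrow> real"
  where "dist_endo A B = norm (A - B)"

definition sgn_endo :: "'a endo \<Rightarrow> 'a endo"
  where "sgn_endo A = inverse (norm A) *\<^sub>R A"

definition uniformity_endo :: "('a endo \<times> 'a endo) filter"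
  where "uniformity_endo = (INF e\<in>{0 <..}. principal {(x, y). dist x y < e})"

definition open_endo :: "'a endo set \<Rightarrow> bool"
  where "open_endo S = (\<forall>x\<in>S. \<forall>\<^sub>F (x', y) in uniformity. x' = x \<longrightarrow> y \<in> S)"

instance
proof
  fix A B C :: "'a endo" and r t :: real
  show "A + B + C = A + (B + C)" "A + B = B + A" "0 + A = A" "- A + A = 0" "A - B = A + - B"
    by (transfer; simp)+
  show "A * B * C = A * (B * C)"
    by transfer (auto intro: blinfun_eqI)
  show "(A + B) * C = A * C + B * C"
    by transfer (simp add: bounded_bilinear.add_left[OF bounded_bilinear_blinfun_compose])
  show "A * (B + C) = A * B + A * C"
    by transfer (simp add: bounded_bilinear.add_right[OF bounded_bilinear_blinfun_compose])
  show "1 * A = A" "A * 1 = A"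
    by (transfer; auto intro!: blinfun_eqI)+
  show "r *\<^sub>R (A + B) = r *\<^sub>R A + r *\<^sub>R B"
    "(r + t) *\<^sub>R A = r *\<^sub>R A + t *\<^sub>R A" "r *\<^sub>R t *\<^sub>R A = (r * t) *\<^sub>R A" "1 *\<^sub>R A = A"
    by (transfer; simp add: scaleR_add_right scaleR_add_left)+
  show "(r *\<^sub>R A) * B = r *\<^sub>R (A * B)"
    by transfer (simp add: bounded_bilinear.scaleR_left[OF bounded_bilinear_blinfun_compose])
  show "A * (r *\<^sub>R B) = r *\<^sub>R (A * B)"
    by transfer (simp add: bounded_bilinear.scaleR_right[OF bounded_bilinear_blinfun_compose])
  show "dist A B = norm (A - B)" by (rule dist_endo_def)
  show "sgn A = inverse (norm A) *\<^sub>R A" by (rule sgn_endo_def)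
  show "uniformity = (INF e\<in>{0 <..}. principal {(x :: 'a endo, y). dist x y < e})"
    by (rule uniformity_endo_def)
  show "open S = (\<forall>x\<in>S. \<forall>\<^sub>F (x', y) in uniformity. x' = x \<longrightarrow> y \<in> S)" for S :: "'a endo set"
    by (rule open_endo_def)
  show "norm A = 0 \<longleftrightarrow> A = 0" by transfer simp
  show "norm (A + B) \<le> norm A + norm B" by transfer (rule norm_triangle_ineq)
  show "norm (r *\<^sub>R A) = \<bar>r\<bar> * norm A" by transfer simp
  show "norm (A * B) \<le> norm A * norm B" by transfer (rule norm_blinfun_compose)
qed

end

instantiation endo :: (complex_banach) complex_banach
begin

lift_definition scaleC_endo :: "complex \<Rightarrow> 'a endo \<Rightarrow> 'a endo" is
  "\<lambda>c A. Blinfun (\<lambda>x. c *\<^sub>C x) o\<^sub>L A"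
  by (simp add: bounded_linear_Blinfun_apply[OF bounded_linear_scaleC] scaleC_scaleC mult.commute)

instance
proof
  fix A B :: "'a endo" and r :: real and c d :: complex
  note app = bounded_linear_Blinfun_apply[OF bounded_linear_scaleC]
  show "c *\<^sub>C (A + B) = c *\<^sub>C A + c *\<^sub>C B"
    by transfer (auto intro!: blinfun_eqI simp: app blinfun.add_left scaleC_add_right)
  show "(c + d) *\<^sub>C A = c *\<^sub>C A + d *\<^sub>C A"
    by transfer (auto intro!: blinfun_eqI simp: app blinfun.add_left scaleC_add_left)
  show "c *\<^sub>C d *\<^sub>C A = (c * d) *\<^sub>C A"
    by transfer (auto intro!: blinfun_eqI simp: app scaleC_scaleC)
  show "complex_of_real r *\<^sub>C A = r *\<^sub>R A"
    by transfer (auto intro!: blinfun_eqI simp: app blinfun.scaleR_left scaleC_of_real)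
  show "norm (c *\<^sub>C A) = cmod c * norm A"
  proof transfer
    fix c :: complex and A :: "'a \<Rightarrow>\<^sub>L 'a"
    have le: "norm (Blinfun (\<lambda>x. d *\<^sub>C x) o\<^sub>L B) \<le> cmod d * norm B" for d and B :: "'a \<Rightarrow>\<^sub>L 'a"
    proof (rule norm_blinfun_bound)
      show "norm (blinfun_apply (Blinfun (\<lambda>x. d *\<^sub>C x) o\<^sub>L B) x) \<le> cmod d * norm B * norm x" for x
        using mult_left_mono[OF norm_blinfun[of B x], of "cmod d"]
        by (simp add: app norm_scaleC mult.assoc)
    qed simp
    show "norm (Blinfun (\<lambda>x. c *\<^sub>C x) o\<^sub>L A) = cmod c * norm A"
    proof (cases "c = 0")
      case True
      then show ?thesis using le[of c A] by simp
    next
      case False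
      have "A = Blinfun (\<lambda>x. inverse c *\<^sub>C x) o\<^sub>L (Blinfun (\<lambda>x. c *\<^sub>C x) o\<^sub>L A)"
        using False by (auto intro!: blinfun_eqI simp: app scaleC_scaleC scaleC_one)
      then have "norm A \<le> cmod (inverse c) * norm (Blinfun (\<lambda>x. c *\<^sub>C x) o\<^sub>L A)"
        using le by metis
      then have "cmod c * norm A \<le> norm (Blinfun (\<lambda>x. c *\<^sub>C x) o\<^sub>L A)"
        using False by (simp add: norm_divide inverse_eq_divide field_simps)
      then show ?thesis using le[of c A] by simp
    qed
  qed
next
  fix X :: "nat \<Rightarrow> 'a endo"
  assume X: "Cauchy X"
  let ?K = "{A :: 'a \<Rightarrow>\<^sub>L 'a. \<forall>c x. blinfun_apply A (c *\<^sub>C x) = c *\<^sub>C blinfun_apply A x}"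
  have dist: "dist (Rep_endo A) (Rep_endo B) = dist A B" for A B :: "'a endo"
    by (simp add: dist_endo_def dist_norm norm_endo.rep_eq minus_endo.rep_eq)
  have "Cauchy (\<lambda>n. Rep_endo (X n))"
    using X by (simp add: Cauchy_def dist)
  then obtain L where L: "(\<lambda>n. Rep_endo (X n)) \<longlonglongrightarrow> L"
    by (auto simp: Cauchy_convergent_iff convergent_def)
  then have "L \<in> ?K"
    using closed_sequentially[OF closed_endo_carrier _ L] Rep_endo by blast
  then have "Rep_endo (Abs_endo L) = L"
    by (rule Abs_endo_inverse)
  then have "X \<longlonglongrightarrow> Abs_endo L"
    using L by (simp add: lim_sequentially flip: dist)
  then show "convergent X"
    by (auto simp: convergent_def)
qed

end


section \<open>Condensed sets\<close>

unbundle cardinal_syntax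

definition uncountable_strong_limit :: "'u rel \<Rightarrow> bool" where
  "uncountable_strong_limit \<kappa> \<longleftrightarrow> Card_order \<kappa> \<and> natLeq <o \<kappa> \<and>
     (\<forall>A :: 'u set. |A| <o \<kappa> \<longrightarrow> |Pow A| <o \<kappa>)"

definition profinite_space :: "'a topology \<Rightarrow> bool" where
  "profinite_space X \<longleftrightarrow> compact_space X \<and> Hausdorff_space X \<and>
     (\<forall>C. connectedin X C \<longrightarrow> (\<exists>a. C \<subseteq> {a}))"

text \<open>Every set of cardinality below \<open>\<kappa>\<close> injects into \<open>'u\<close>, so the profinite topologies on subsets
  of \<open>'u\<close> represent all \<open>\<kappa>\<close>-small profinite sets up to homeomorphism.\<close>

definition site :: "'u rel \<Rightarrow> 'u topology set" where
  "site \<kappa> = {T. profinite_space T \<and> |topspace T| <o \<kappa>}"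

text \<open>Continuous maps with a fixed value off the domain, so that equality is equality of maps.\<close>

definition cmaps :: "'a topology \<Rightarrow> 'b topology \<Rightarrow> ('a \<Rightarrow> 'b) set" where
  "cmaps T X = {g \<in> extensional (topspace T). continuous_map T X g}"

record ('u, 'x) presheaf =
  sections :: "'u topology \<Rightarrow> 'x set"
  pullback :: "'u topology \<Rightarrow> 'u topology \<Rightarrow> ('u \<Rightarrow> 'u) \<Rightarrow> 'x \<Rightarrow> 'x"
    \<comment> \<open>\<open>pullback F R T h\<close> is restriction along \<open>h : R \<rightarrow> T\<close>\<close>

text \<open>The overlap condition is stated on all pairs of maps with equal composites to \<open>T\<close>, i.e. on all
  objects over the fibre product. The case \<open>n = 0\<close> is the empty cover of the empty set.\<close>

definition condensed_set :: "'u rel \<Rightarrow> ('u, 'x, 'z) presheaf_scheme \<Rightarrow> bool" where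
  "condensed_set \<kappa> F \<longleftrightarrow>
     (\<forall>R\<in>site \<kappa>. \<forall>T\<in>site \<kappa>. \<forall>h\<in>cmaps R T. \<forall>x\<in>sections F T. pullback F R T h x \<in> sections F R) \<and>
     (\<forall>T\<in>site \<kappa>. \<forall>x\<in>sections F T. pullback F T T (restrict id (topspace T)) x = x) \<and>
     (\<forall>Q\<in>site \<kappa>. \<forall>R\<in>site \<kappa>. \<forall>T\<in>site \<kappa>. \<forall>k\<in>cmaps Q R. \<forall>h\<in>cmaps R T. \<forall>x\<in>sections F T.
        pullback F Q T (compose (topspace Q) h k) x = pullback F Q R k (pullback F R T h x)) \<and>
     (\<forall>T\<in>site \<kappa>. \<forall>(n::nat) Y h x.
        (\<forall>i<n. Y i \<in> site \<kappa> \<and> h i \<in> cmaps (Y i) T \<and> x i \<in> sections F (Y i)) \<longrightarrow>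
        topspace T = (\<Union>i<n. h i ` topspace (Y i)) \<longrightarrow>
        (\<forall>i<n. \<forall>j<n. \<forall>R\<in>site \<kappa>. \<forall>u\<in>cmaps R (Y i). \<forall>v\<in>cmaps R (Y j).
           (\<forall>r\<in>topspace R. h i (u r) = h j (v r)) \<longrightarrow>
           pullback F R (Y i) u (x i) = pullback F R (Y j) v (x j)) \<longrightarrow>
        (\<exists>!y. y \<in> sections F T \<and> (\<forall>i<n. pullback F (Y i) T (h i) y = x i)))"

definition condensed_hom ::
    "'u rel \<Rightarrow> ('u, 'x, 'z) presheaf_scheme \<Rightarrow> ('u, 'y, 'w) presheaf_scheme \<Rightarrow> ('u topology \<Rightarrow> 'x \<Rightarrow> 'y) set"
  where
  "condensed_hom \<kappa> F G =
     {\<Phi> \<in> (\<Pi>\<^sub>E T\<in>site \<kappa>. sections F T \<rightarrow>\<^sub>E sections G T).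
        \<forall>R\<in>site \<kappa>. \<forall>T\<in>site \<kappa>. \<forall>h\<in>cmaps R T. \<forall>x\<in>sections F T.
          \<Phi> R (pullback F R T h x) = pullback G R T h (\<Phi> T x)}"

definition condensed_of_top :: "'b topology \<Rightarrow> ('u, 'u \<Rightarrow> 'b) presheaf" where
  "condensed_of_top X =
     \<lparr> sections = (\<lambda>T. cmaps T X), pullback = (\<lambda>R T h g. compose (topspace R) g h) \<rparr>"

definition condensed_of_map ::
    "'u rel \<Rightarrow> 'a topology \<Rightarrow> ('a \<Rightarrow> 'b) \<Rightarrow> 'u topology \<Rightarrow> ('u \<Rightarrow> 'a) \<Rightarrow> ('u \<Rightarrow> 'b)" where
  "condensed_of_map \<kappa> X \<phi> = (\<lambda>T\<in>site \<kappa>. \<lambda>g\<in>cmaps T X. compose (topspace T) \<phi> g)"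


section \<open>Condensed complex vector spaces\<close>

definition cont_ring :: "'u topology \<Rightarrow> ('u \<Rightarrow> complex) ring" where
  "cont_ring T =
     \<lparr> carrier = cmaps T euclidean,
       mult = (\<lambda>k l. \<lambda>t\<in>topspace T. k t * l t), one = (\<lambda>t\<in>topspace T. 1),
       zero = (\<lambda>t\<in>topspace T. 0), add = (\<lambda>k l. \<lambda>t\<in>topspace T. k t + l t) \<rparr>"

record ('u, 'x) mod_presheaf = "('u, 'x) presheaf" +
  zero_sec :: "'u topology \<Rightarrow> 'x"
  add_sec :: "'u topology \<Rightarrow> 'x \<Rightarrow> 'x \<Rightarrow> 'x"
  smult_sec :: "'u topology \<Rightarrow> ('u \<Rightarrow> complex) \<Rightarrow> 'x \<Rightarrow> 'x"

definition sec_module ::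
    "('u, 'x, 'z) mod_presheaf_scheme \<Rightarrow> 'u topology \<Rightarrow> ('u \<Rightarrow> complex, 'x) module" where
  "sec_module M T =
     \<lparr> carrier = sections M T, mult = undefined, one = undefined,
       zero = zero_sec M T, add = add_sec M T, smult = smult_sec M T \<rparr>"

definition condensed_vector_space :: "'u rel \<Rightarrow> ('u, 'x, 'z) mod_presheaf_scheme \<Rightarrow> bool" where
  "condensed_vector_space \<kappa> M \<longleftrightarrow> condensed_set \<kappa> M \<and>
     (\<forall>T\<in>site \<kappa>. Module.module (cont_ring T) (sec_module M T)) \<and>
     (\<forall>R\<in>site \<kappa>. \<forall>T\<in>site \<kappa>. \<forall>h\<in>cmaps R T. \<forall>x\<in>sections M T.
        (\<forall>y\<in>sections M T. pullback M R T h (add_sec M T x y) =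
           add_sec M R (pullback M R T h x) (pullback M R T h y)) \<and>
        (\<forall>k\<in>cmaps T euclidean. pullback M R T h (smult_sec M T k x) =
           smult_sec M R (compose (topspace R) k h) (pullback M R T h x)))"

definition condensed_linear_hom ::
    "'u rel \<Rightarrow> ('u, 'x, 'z) mod_presheaf_scheme \<Rightarrow> ('u, 'y, 'w) mod_presheaf_scheme \<Rightarrow>
      ('u topology \<Rightarrow> 'x \<Rightarrow> 'y) set" where
  "condensed_linear_hom \<kappa> M N =
     {\<Phi> \<in> condensed_hom \<kappa> M N.
        condensed_vector_space \<kappa> M \<and> condensed_vector_space \<kappa> N \<and>
        (\<forall>T\<in>site \<kappa>. \<forall>x\<in>sections M T.
           (\<forall>y\<in>sections M T. \<Phi> T (add_sec M T x y) = add_sec N T (\<Phi> T x) (\<Phi> T y)) \<and>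
           (\<forall>k\<in>cmaps T euclidean. \<Phi> T (smult_sec M T k x) = smult_sec N T k (\<Phi> T x)))}"

definition condensed_banach :: "('u, 'u \<Rightarrow> 'w::complex_banach) mod_presheaf" where
  "condensed_banach = presheaf.extend (condensed_of_top (euclidean :: 'w topology))
     \<lparr> zero_sec = (\<lambda>T. \<lambda>t\<in>topspace T. 0),
       add_sec = (\<lambda>T x y. \<lambda>t\<in>topspace T. x t + y t),
       smult_sec = (\<lambda>T k x. \<lambda>t\<in>topspace T. k t *\<^sub>C x t) \<rparr>"


section \<open>The condensed vector space of \<open><p\<close>-measures\<close>

text \<open>A profinite set is the limit of its finite discrete quotients, which are its finite partitions
  into open (hence clopen) blocks, ordered by refinement. A measure on \<open>X\<close> is accordingly a
  family assigning to each such partition \<open>P\<close> an element of \<open>\<complex>[P]\<close>.\<close>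

type_synonym 'a meas = "'a set set \<Rightarrow> 'a set \<Rightarrow> complex"

definition clopen_partitions :: "'a topology \<Rightarrow> 'a set set set" where
  "clopen_partitions X = {P. finite P \<and> partition_on (topspace X) P \<and> (\<forall>B\<in>P. openin X B)}"

definition lq_ball :: "real \<Rightarrow> real \<Rightarrow> 't set \<Rightarrow> ('t \<Rightarrow> complex) topology" where
  "lq_ball q c P =
     subtopology (product_topology (\<lambda>_. euclidean) P) {x. (\<Sum>t\<in>P. cmod (x t) powr q) \<le> c}"

text \<open>Push-forward along the quotient map from a partition \<open>P\<close> to a coarser partition \<open>Q\<close>, which
  sends a block of \<open>P\<close> to the block of \<open>Q\<close> containing it.\<close>

definition push :: "'a set set \<Rightarrow> 'a set set \<Rightarrow> ('a set \<Rightarrow> complex) \<Rightarrow> 'a set \<Rightarrow> complex" where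
  "push P Q x = (\<lambda>C\<in>Q. \<Sum>B\<in>{B\<in>P. B \<subseteq> C}. x B)"

definition Mq_ball :: "real \<Rightarrow> real \<Rightarrow> 'a topology \<Rightarrow> 'a meas topology" where
  "Mq_ball q c X =
     subtopology (product_topology (lq_ball q c) (clopen_partitions X))
       {\<mu>. \<forall>P\<in>clopen_partitions X. \<forall>Q\<in>clopen_partitions X.
             refines (topspace X) P Q \<longrightarrow> push P Q (\<mu> P) = \<mu> Q}"

definition meas_zero :: "'a topology \<Rightarrow> 'a meas" where
  "meas_zero X = (\<lambda>P\<in>clopen_partitions X. \<lambda>B\<in>P. 0)"

definition meas_add :: "'a topology \<Rightarrow> 'a meas \<Rightarrow> 'a meas \<Rightarrow> 'a meas" where
  "meas_add X \<mu> \<nu> = (\<lambda>P\<in>clopen_partitions X. \<lambda>B\<in>P. \<mu> P B + \<nu> P B)"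

definition meas_smult :: "'a topology \<Rightarrow> complex \<Rightarrow> 'a meas \<Rightarrow> 'a meas" where
  "meas_smult X c \<mu> = (\<lambda>P\<in>clopen_partitions X. \<lambda>B\<in>P. c * \<mu> P B)"

text \<open>The unions over \<open>c\<close> and \<open>q\<close> are unions of condensed sets. They are directed and covers are
  finite, so the union of the presheaves is already a sheaf: a section over \<open>T\<close> is a map
  that is continuous into a single \<open>Mq_ball q c X\<close>.\<close>

definition M_lt :: "real \<Rightarrow> 'a topology \<Rightarrow> ('u, 'u \<Rightarrow> 'a meas) mod_presheaf" where
  "M_lt p X =
     \<lparr> sections = (\<lambda>T. \<Union>q\<in>{0<..<p}. \<Union>c\<in>{0<..}. cmaps T (Mq_ball q c X)),
       pullback = (\<lambda>R T h g. compose (topspace R) g h),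
       zero_sec = (\<lambda>T. \<lambda>t\<in>topspace T. meas_zero X),
       add_sec = (\<lambda>T x y. \<lambda>t\<in>topspace T. meas_add X (x t) (y t)),
       smult_sec = (\<lambda>T k x. \<lambda>t\<in>topspace T. meas_smult X (k t) (x t)) \<rparr>"

definition dirac :: "'a topology \<Rightarrow> 'a \<Rightarrow> 'a meas" where
  "dirac X a = (\<lambda>P\<in>clopen_partitions X. \<lambda>B\<in>P. if a \<in> B then 1 else 0)"

text \<open>The measure \<open>\<Sum>t. m t \<cdot> \<delta>\<^sub>t\<close> with mass \<open>m t\<close> at each point \<open>t\<close>, for absolutely summable \<open>m\<close>.\<close>

definition meas_of_masses :: "'a topology \<Rightarrow> ('a \<Rightarrow> complex) \<Rightarrow> 'a meas" where
  "meas_of_masses X m = (\<lambda>P\<in>clopen_partitions X. \<lambda>B\<in>P. \<Sum>\<^sub>\<infinity>t\<in>B. m t)"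

definition is_liquid_extension ::
    "'u rel \<Rightarrow> real \<Rightarrow> 'a topology \<Rightarrow> ('a \<Rightarrow> 'w::complex_banach) \<Rightarrow>
      ('u topology \<Rightarrow> ('u \<Rightarrow> 'a meas) \<Rightarrow> ('u \<Rightarrow> 'w)) \<Rightarrow> bool" where
  "is_liquid_extension \<kappa> p X \<phi> \<Phi> \<longleftrightarrow>
     \<Phi> \<in> condensed_linear_hom \<kappa> (M_lt p X) condensed_banach \<and>
     (\<forall>T\<in>site \<kappa>. \<forall>g\<in>cmaps T X.
        \<Phi> T (condensed_of_map \<kappa> X (dirac X) T g) = condensed_of_map \<kappa> X \<phi> T g)"

definition liquid_extension ::
    "'u rel \<Rightarrow> real \<Rightarrow> 'a topology \<Rightarrow> ('a \<Rightarrow> 'w::complex_banach) \<Rightarrow>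
      'u topology \<Rightarrow> ('u \<Rightarrow> 'a meas) \<Rightarrow> ('u \<Rightarrow> 'w)" where
  "liquid_extension \<kappa> p X \<phi> = (THE \<Phi>. is_liquid_extension \<kappa> p X \<phi> \<Phi>)"


section \<open>Points\<close>

definition pt :: "'u topology" where
  "pt = discrete_topology {undefined}"

definition point :: "'x \<Rightarrow> 'u \<Rightarrow> 'x" where
  "point x = (\<lambda>t\<in>topspace pt. x)"

definition underlying_set :: "('u, 'u \<Rightarrow> 'x, 'z) presheaf_scheme \<Rightarrow> 'x set" where
  "underlying_set F = {x. point x \<in> sections F pt}"

definition eval_point :: "('u topology \<Rightarrow> ('u \<Rightarrow> 'x) \<Rightarrow> ('u \<Rightarrow> 'y)) \<Rightarrow> 'x \<Rightarrow> 'y" where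
  "eval_point \<Phi> x = \<Phi> pt (point x) undefined"


section \<open>The data attached to an operator and an entire function\<close>

text \<open>In \<open>nat option\<close>, the point \<open>\<infinity>\<close> is \<open>None\<close>.\<close>

abbreviation N_infty :: "nat option topology" where
  "N_infty \<equiv> Alexandroff_compactification (discrete_topology UNIV)"

definition phi :: "(nat \<Rightarrow> complex) \<Rightarrow> 'v::complex_banach endo \<Rightarrow> nat option \<Rightarrow> 'v endo" where
  "phi s T = (\<lambda>None \<Rightarrow> 0 | Some n \<Rightarrow> s n *\<^sub>C T ^ n)"

definition mu :: "(nat \<Rightarrow> complex) \<Rightarrow> nat option meas" where
  "mu s = meas_of_masses N_infty (\<lambda>None \<Rightarrow> 0 | Some n \<Rightarrow> s n)"

end

theory Submission
  imports Defs
begin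

text \<open>
  A measure in \<open>M\<^sub>q\<close> on \<open>\<nat> \<union> {\<infinity>}\<close> is determined by its masses, which form an \<open>\<ell>\<^sup>q\<close> and
  hence an \<open>\<ell>\<^sup>1\<close> family, bounded uniformly on each ball. If \<open>\<phi>(n) \<rightarrow> 0 = \<phi>(\<infinity>)\<close>, the
  series of \<open>\<mu>({n}) \<cdot> \<phi>(n)\<close> therefore converges uniformly on each ball and defines a condensed
  linear extension of \<open>\<phi>\<close>. It is the only one, because finite combinations of Dirac measures are
  dense along convergent sequences and convergent sequences are probed by the profinite set
  \<open>\<nat> \<union> {\<infinity>}\<close> itself. As \<open>f\<close> is entire, \<open>\<surd>a\<^sub>n\<close> decays faster than every geometric sequence, so
  \<open>\<mu>\<^sub>f\<close> is a measure, \<open>\<phi>\<close> tends to \<open>0\<close>, and the series for \<open>\<mu>\<^sub>f\<close> is that of \<open>\<surd>a\<^sub>n \<cdot> \<surd>a\<^sub>n \<cdot> T\<^sup>n\<close>.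
\<close>

section \<open>Inequalities for powers\<close>

text \<open>A condensed linear map on measures is controlled only through its values on sections,
  and a section must stay inside one ball with fixed q and c. So an approximation of a measure is
  useful only if it loses no radius. Replacing each block of a partition by one chosen point,
  weighted with the mass of the block, has this property, since for q \<le> 1 the q-th power of the
  modulus is subadditive. The approximation is moreover exact on every coarser partition, so
  convergence is eventual equality in each coordinate. Equality of linear maps can be tested on
  points, because sections of a Banach space are functions.

  Splitting the coefficient into two equal square roots lets one decay statement serve twice: |s n|
  R^n tends to 0 for each R, which beats the growth of the powers of T in \<phi> and gives l^q
  summability in \<mu>, however small p is. As \<phi> vanishes at \<infinity>, the extension can be
  written with the masses at finite points alone, although a measure may have mass at
  \<infinity>.\<close>

lemma powr_add_le:
  fixes a b q :: real
  assumes "0 \<le> a" "0 \<le> b" "0 < q" "q \<le> 1"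
  shows "(a + b) powr q \<le> a powr q + b powr q"
proof (cases "a + b = 0")
  case False
  then have s: "0 < a + b" using assms by linarith
  \<comment> \<open>On [0, 1] a power with exponent at most 1 lies above the identity; this is
    applied to the shares of a and b, which add up to 1.\<close>
  have "x / (a + b) \<le> x powr q / (a + b) powr q" if "0 \<le> x" "x \<le> a + b" for x
    using powr_mono'[of q 1 "x / (a + b)"] that s assms by (simp add: powr_divide)
  from this[of a] this[of b] have "a / (a + b) + b / (a + b) \<le> (a powr q + b powr q) / (a + b) powr q"
    using assms by (simp add: add_divide_distrib)
  then show ?thesis using s by (simp add: field_simps flip: add_divide_distrib)
qed (use assms in simp)

text \<open>Subadditivity of the q-th power, iterated: merging masses does not increase an l^q
  bound. Over an infinite index set both sums are zero.\<close>

lemma norm_sum_powr_le: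
  fixes f :: "'i \<Rightarrow> 'b::real_normed_vector"
  assumes q: "0 < q" "q \<le> 1"
  shows "norm (sum f A) powr q \<le> (\<Sum>i\<in>A. norm (f i) powr q)"
proof (induction A rule: infinite_finite_induct)
  case (insert i A)
  have "norm (f i + sum f A) powr q \<le> (norm (f i) + norm (sum f A)) powr q"
    by (rule powr_mono2) (use q norm_triangle_ineq in auto)
  also have "\<dots> \<le> norm (f i) powr q + norm (sum f A) powr q"
    by (rule powr_add_le) (use q in auto)
  finally show ?case using insert by simp
qed (use q in simp_all)

text \<open>Each term satisfies \<open>f i powr q \<le> c\<close>, so the surplus factor
  \<open>f i powr (r - q)\<close> is at most \<open>c powr ((r - q) / q)\<close>. The bound does not
  depend on the number of terms, so one constant serves all partitions; r = 1 gives the passage from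
  l^q to l^1.\<close>

lemma sum_powr_exponent_mono:
  fixes f :: "'i \<Rightarrow> real"
  assumes fin: "finite A" and nn: "\<And>i. i \<in> A \<Longrightarrow> 0 \<le> f i"
    and q: "0 < q" "q \<le> r" and le: "(\<Sum>i\<in>A. f i powr q) \<le> c"
  shows "(\<Sum>i\<in>A. f i powr r) \<le> c powr (r / q)"
proof -
  have c: "0 \<le> c" using le sum_nonneg[of A "\<lambda>i. f i powr q"] by simp
  have "f i powr r \<le> f i powr q * c powr ((r - q) / q)" if i: "i \<in> A" for i
  proof -
    have "f i powr q \<le> c"
      using member_le_sum[OF i, of "\<lambda>i. f i powr q"] fin le by simp
    then have "(f i powr q) powr ((r - q) / q) \<le> c powr ((r - q) / q)"
      by (rule powr_mono2[rotated 2]) (use q in auto)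
    then have "f i powr (r - q) \<le> c powr ((r - q) / q)"
      using q by (simp add: powr_powr)
    then have "f i powr q * f i powr (r - q) \<le> f i powr q * c powr ((r - q) / q)"
      by (rule mult_left_mono) simp
    then show ?thesis by (simp flip: powr_add)
  qed
  then have "(\<Sum>i\<in>A. f i powr r) \<le> (\<Sum>i\<in>A. f i powr q) * c powr ((r - q) / q)"
    unfolding sum_distrib_right by (rule sum_mono)
  also have "\<dots> \<le> c powr 1 * c powr ((r - q) / q)"
    using le c by (intro mult_right_mono) auto
  also have "\<dots> = c powr (r / q)"
    unfolding powr_add[symmetric] using q by (simp add: diff_divide_distrib)
  finally show ?thesis .
qed

section \<open>Objects and sheaves on the site\<close>

lemma countable_ordLess_strong_limit:
  assumes \<kappa>: "uncountable_strong_limit (\<kappa> :: 'u rel)" and A: "countable (A :: 'a set)"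
  shows "|A| <o \<kappa>"
proof -
  have "|A| \<le>o natLeq"
    using A by (metis card_of_nat card_of_ordLeqI countable_def ordLeq_ordIso_trans UNIV_I)
  then show ?thesis
    using \<kappa> ordLeq_ordLess_trans unfolding uncountable_strong_limit_def by blast
qed

text \<open>Objects of the site are topologies on \<open>'u\<close>; this lets a countable space be
  copied into that type.\<close>

lemma inj_into_strong_limit:
  assumes \<kappa>: "uncountable_strong_limit (\<kappa> :: 'u rel)" and A: "countable (A :: 'a set)"
  obtains e :: "'a \<Rightarrow> 'u" where "inj_on e A"
proof -
  have "|A| \<le>o \<kappa>"
    using countable_ordLess_strong_limit[OF assms] by (rule ordLess_imp_ordLeq)
  moreover have "\<kappa> =o |Field \<kappa>|"
    using \<kappa> card_of_Field_ordIso ordIso_symmetric unfolding uncountable_strong_limit_def by blast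
  ultimately have "|A| \<le>o |Field \<kappa>|"
    by (rule ordLeq_ordIso_trans)
  then show ?thesis
    using that unfolding card_of_ordLeq[symmetric] by blast
qed

lemma topspace_pt [simp]: "topspace pt = {undefined}"
  by (simp add: pt_def)

lemma point_undefined [simp]: "point x undefined = x"
  by (simp add: point_def)

lemma pt_in_site:
  assumes "uncountable_strong_limit \<kappa>"
  shows "pt \<in> site \<kappa>"
proof -
  have "\<exists>a. C \<subseteq> {a}" if "connectedin pt C" for C :: "'a set"
    using connectedin_subset_topspace[OF that] by auto
  then show ?thesis
    using countable_ordLess_strong_limit[OF assms, of "{undefined}"]
    by (simp add: site_def profinite_space_def pt_def compact_space_discrete_topology)
qed

lemma point_in_cmaps: "x \<in> topspace X \<Longrightarrow> point x \<in> cmaps pt X"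
  by (auto simp: cmaps_def point_def pt_def)

lemma compose_in_cmaps:
  "g \<in> cmaps T X \<Longrightarrow> h \<in> cmaps R T \<Longrightarrow> compose (topspace R) g h \<in> cmaps R X"
  unfolding cmaps_def
  by (auto simp: compose_def intro!: continuous_map_eq[OF continuous_map_compose[of R T h X g]])

lemma cmaps_trans:
  "g \<in> cmaps T X \<Longrightarrow> continuous_map X Z id \<Longrightarrow> g \<in> cmaps T Z"
  unfolding cmaps_def using continuous_map_compose[of T X g Z id] by auto

text \<open>One criterion serves both a Banach space, with a single target, and the measures, with
  the family of all balls. Sections glue pointwise; the glued map is continuous because a finite
  jointly surjective family of compact spaces over a Hausdorff space is a quotient map.\<close>

lemma condensed_set_Union_cmaps:
  fixes F :: "('u, 'u \<Rightarrow> 'b, 'z) presheaf_scheme"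
  assumes \<kappa>: "uncountable_strong_limit \<kappa>"
    and sec: "sections F = (\<lambda>T. \<Union>X\<in>\<X>. cmaps T X)"
    and pb: "pullback F = (\<lambda>R T h g. compose (topspace R) g h)"
    and ne: "\<X> \<noteq> {}"
    and dir: "\<And>X Y. X \<in> \<X> \<Longrightarrow> Y \<in> \<X> \<Longrightarrow>
      \<exists>Z\<in>\<X>. continuous_map X Z id \<and> continuous_map Y Z id"
  shows "condensed_set \<kappa> F"
  unfolding condensed_set_def
proof (intro conjI ballI allI impI)
  fix R T :: "'u topology" and h x assume "h \<in> cmaps R T" "x \<in> sections F T"
  then show "pullback F R T h x \<in> sections F R"
    by (auto simp: sec pb intro: compose_in_cmaps)
next
  fix T :: "'u topology" and x assume "x \<in> sections F T"
  then have "x \<in> extensional (topspace T)" by (auto simp: sec cmaps_def)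
  then show "pullback F T T (restrict id (topspace T)) x = x"
    by (auto simp: pb compose_def extensional_def fun_eq_iff)
next
  fix Q R T :: "'u topology" and k h x assume "k \<in> cmaps Q R" "h \<in> cmaps R T" "x \<in> sections F T"
  then have "k q \<in> topspace R" if "q \<in> topspace Q" for q
    using that by (auto simp: cmaps_def continuous_map_def)
  then show "pullback F Q T (compose (topspace Q) h k) x = pullback F Q R k (pullback F R T h x)"
    by (auto simp: pb compose_def fun_eq_iff)
next
  fix T :: "'u topology" and n Y h x
  assume T: "T \<in> site \<kappa>"
    and Y: "\<forall>i<n::nat. Y i \<in> site \<kappa> \<and> h i \<in> cmaps (Y i) T \<and> x i \<in> sections F (Y i)"
    and cover: "topspace T = (\<Union>i<n. h i ` topspace (Y i))"
    and compat: "\<forall>i<n. \<forall>j<n. \<forall>R\<in>site \<kappa>. \<forall>u\<in>cmaps R (Y i). \<forall>v\<in>cmaps R (Y j).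
           (\<forall>r\<in>topspace R. h i (u r) = h j (v r)) \<longrightarrow>
           pullback F R (Y i) u (x i) = pullback F R (Y j) v (x j)"
  have x_eq: "x i r = x j r'"
    if "i < n" "j < n" "r \<in> topspace (Y i)" "r' \<in> topspace (Y j)" "h i r = h j r'" for i j r r'
  proof -
    \<comment> \<open>The overlap condition is probed with the one-point space, mapped to r and to
      r'; equality of sections over it is equality of values.\<close>
    have "pullback F pt (Y i) (point r) (x i) = pullback F pt (Y j) (point r') (x j)"
      by (rule compat[rule_format, OF _ _ pt_in_site[OF \<kappa>]])
        (use that in \<open>simp_all add: point_in_cmaps\<close>)
    from fun_cong[OF this, of undefined] show ?thesis
      by (simp add: pb compose_def)
  qed
  \<comment> \<open>Finiteness of the cover enters here: directedness moves the local sections into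
    one common target, one at a time. The empty cover still needs some target, hence
    \<open>ne\<close>.\<close>
  have "\<exists>Z\<in>\<X>. \<forall>i<m. x i \<in> cmaps (Y i) Z" if "m \<le> n" for m
    using that
  proof (induction m)
    case (Suc m)
    then obtain Z where Z: "Z \<in> \<X>" "\<forall>i<m. x i \<in> cmaps (Y i) Z" by auto
    obtain Z' where Z': "Z' \<in> \<X>" "x m \<in> cmaps (Y m) Z'"
      using Y[rule_format, of m] Suc.prems by (auto simp: sec)
    obtain W where "W \<in> \<X>" "continuous_map Z W id" "continuous_map Z' W id"
      using dir[OF Z(1) Z'(1)] by blast
    then show ?case using Z Z' cmaps_trans by (metis less_Suc_eq)
  qed (use ne in auto)
  then obtain Z where Z: "Z \<in> \<X>" "\<And>i. i < n \<Longrightarrow> x i \<in> cmaps (Y i) Z" by blast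
  have "\<exists>v. \<forall>i<n. \<forall>r\<in>topspace (Y i). h i r = t \<longrightarrow> x i r = v" for t
  proof (cases "\<exists>i<n. \<exists>r\<in>topspace (Y i). h i r = t")
    case True
    then obtain i r where "i < n" "r \<in> topspace (Y i)" "h i r = t" by blast
    then show ?thesis using x_eq by (intro exI[of _ "x i r"]) metis
  qed blast
  then obtain v where v: "\<And>i r. i < n \<Longrightarrow> r \<in> topspace (Y i) \<Longrightarrow> x i r = v (h i r)"
    by metis
  define y where "y = restrict v (topspace T)"
  have hY: "h i r \<in> topspace T" if "i < n" "r \<in> topspace (Y i)" for i r
    using cover that by blast
  \<comment> \<open>A closed set in Z has closed, hence compact, preimages in the Y i. Their images
    in the Hausdorff space T are closed, and finitely many of them make up the preimage under
    y.\<close>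
  have "continuous_map T Z y"
    unfolding continuous_map_closedin
  proof (intro conjI funcsetI allI impI)
    fix t assume t: "t \<in> topspace T"
    then obtain i r where "i < n" "r \<in> topspace (Y i)" "t = h i r" using cover by auto
    then show "y t \<in> topspace Z"
      using v Z(2)[of i] t by (auto simp: y_def cmaps_def continuous_map_def Pi_iff)
  next
    fix C assume C: "closedin Z C"
    have "closedin T (h i ` {r \<in> topspace (Y i). x i r \<in> C})" if i: "i < n" for i
    proof -
      have "closedin (Y i) {r \<in> topspace (Y i). x i r \<in> C}"
        using Z(2)[OF i] C by (auto simp: cmaps_def continuous_map_closedin)
      moreover have "compact_space (Y i)" using Y i by (auto simp: site_def profinite_space_def)
      ultimately have "compactin (Y i) {r \<in> topspace (Y i). x i r \<in> C}"
        by (simp add: closedin_compact_space)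
      then have "compactin T (h i ` {r \<in> topspace (Y i). x i r \<in> C})"
        using Y i by (auto simp: cmaps_def intro: image_compactin)
      then show ?thesis
        using T by (auto simp: site_def profinite_space_def intro: compactin_imp_closedin)
    qed
    then have "closedin T (\<Union>i<n. h i ` {r \<in> topspace (Y i). x i r \<in> C})"
      by (intro closedin_Union) auto
    moreover have "(\<Union>i<n. h i ` {r \<in> topspace (Y i). x i r \<in> C}) = {t \<in> topspace T. y t \<in> C}"
    proof (intro equalityI subsetI)
      fix t assume "t \<in> {t \<in> topspace T. y t \<in> C}"
      moreover from this obtain i r where "i < n" "r \<in> topspace (Y i)" "t = h i r"
        using cover by auto
      ultimately have "h i r = t" "r \<in> {r \<in> topspace (Y i). x i r \<in> C}"
        using v hY by (auto simp: y_def)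
      then show "t \<in> (\<Union>i<n. h i ` {r \<in> topspace (Y i). x i r \<in> C})"
        using \<open>i < n\<close> by blast
    qed (use v hY in \<open>auto simp: y_def\<close>)
    ultimately show "closedin T {t \<in> topspace T. y t \<in> C}" by simp
  qed
  then have "y \<in> sections F T"
    using Z(1) by (auto simp: sec cmaps_def y_def)
  moreover have "pullback F (Y i) T (h i) y = x i" if i: "i < n" for i
  proof -
    have "x i \<in> extensional (topspace (Y i))" using Z(2)[OF i] by (simp add: cmaps_def)
    then show ?thesis
      using v[OF i] hY[OF i] by (auto simp: pb y_def compose_def fun_eq_iff extensional_def)
  qed
  moreover have "y' = y"
    if y': "y' \<in> sections F T" "\<forall>i<n. pullback F (Y i) T (h i) y' = x i" for y'
  proof
    fix t
    have ext: "y' \<in> extensional (topspace T)" using y' by (auto simp: sec cmaps_def)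
    show "y' t = y t"
    proof (cases "t \<in> topspace T")
      case True
      then obtain i r where ir: "i < n" "r \<in> topspace (Y i)" "t = h i r" using cover by auto
      then have "pullback F (Y i) T (h i) y' r = x i r" using y' by simp
      then show ?thesis using v[OF ir(1,2)] ir hY True by (simp add: pb y_def compose_def)
    qed (use ext in \<open>simp add: y_def extensional_def\<close>)
  qed
  ultimately show "\<exists>!y. y \<in> sections F T \<and> (\<forall>i<n. pullback F (Y i) T (h i) y = x i)"
    by blast
qed

lemma cmaps_eqI:
  "g \<in> cmaps T X \<Longrightarrow> h \<in> cmaps T Y \<Longrightarrow> (\<And>t. t \<in> topspace T \<Longrightarrow> g t = h t) \<Longrightarrow> g = h"
  unfolding cmaps_def by (blast intro: extensionalityI)

lemma restrict_in_cmaps: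
  "continuous_map T X g \<Longrightarrow> restrict g (topspace T) \<in> cmaps T X"
  by (auto simp: cmaps_def)

section \<open>Continuity of the module operations and the ring of continuous functions\<close>

lemma scaleC_zero_left [simp]: "0 *\<^sub>C x = (0 :: 'w::complex_banach)"
  using norm_scaleC[of 0 x] by simp

lemma bounded_bilinear_scaleC: "bounded_bilinear ((*\<^sub>C) :: complex \<Rightarrow> 'w \<Rightarrow> 'w::complex_banach)"
proof
  show "\<exists>K. \<forall>a b. norm (a *\<^sub>C b :: 'w) \<le> norm a * norm b * K"
    by (rule exI[of _ 1]) (simp add: norm_scaleC)
qed (simp_all add: scaleC_add_left scaleC_add_right scaleC_scaleR_commute scaleC_scaleC
    scaleR_conv_of_real mult.commute flip: scaleC_of_real)

text \<open>As T is an abstract topology, continuity passes through the pairing into a product of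
  Euclidean spaces, where the bilinear map is continuous in the metric sense.\<close>

lemma continuous_map_bilinear:
  assumes "bounded_bilinear F" "continuous_map T euclidean f" "continuous_map T euclidean g"
  shows "continuous_map T euclidean (\<lambda>t. F (f t) (g t))"
proof -
  have "continuous_map T (prod_topology euclidean euclidean) (\<lambda>t. (f t, g t))"
    using assms unfolding continuous_map_paired by simp
  moreover have "continuous_map (prod_topology euclidean euclidean) euclidean (\<lambda>(a, b). F a b)"
    using bounded_bilinear.continuous_on[OF assms(1) continuous_on_fst[OF continuous_on_id]
        continuous_on_snd[OF continuous_on_id]]
    by (simp add: euclidean_product_topology case_prod_beta)
  ultimately show ?thesis
    using continuous_map_compose[of T _ "\<lambda>t. (f t, g t)" euclidean "\<lambda>(a, b). F a b"]
    by (simp add: o_def)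
qed

lemma cring_cont_ring: "cring (cont_ring T)"
proof (intro cringI abelian_groupI comm_monoidI)
  have cont: "continuous_map T euclidean x" if "x \<in> carrier (cont_ring T)" for x
    using that by (simp add: cont_ring_def cmaps_def)
  fix x y assume x: "x \<in> carrier (cont_ring T)" and y: "y \<in> carrier (cont_ring T)"
  show "x \<oplus>\<^bsub>cont_ring T\<^esub> y \<in> carrier (cont_ring T)" "x \<otimes>\<^bsub>cont_ring T\<^esub> y \<in> carrier (cont_ring T)"
    using cont[OF x] cont[OF y]
    by (auto simp: cont_ring_def
        intro!: restrict_in_cmaps continuous_intros continuous_map_bilinear[OF bounded_bilinear_mult])
next
  fix x assume x: "x \<in> carrier (cont_ring T)"
  show "\<exists>y\<in>carrier (cont_ring T). y \<oplus>\<^bsub>cont_ring T\<^esub> x = \<zero>\<^bsub>cont_ring T\<^esub>"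
  proof (rule bexI[of _ "\<lambda>t\<in>topspace T. - x t"])
    show "(\<lambda>t\<in>topspace T. - x t) \<in> carrier (cont_ring T)"
      using x by (auto simp: cont_ring_def cmaps_def intro!: continuous_intros)
  qed (auto simp: cont_ring_def)
qed (auto simp: cont_ring_def cmaps_def extensional_def fun_eq_iff algebra_simps)

section \<open>The condensed vector spaces of measures and of a Banach space\<close>

lemma mem_topspace_Mq_ball:
  "\<mu> \<in> topspace (Mq_ball q c X) \<longleftrightarrow>
     \<mu> \<in> extensional (clopen_partitions X) \<and>
     (\<forall>P\<in>clopen_partitions X. \<mu> P \<in> extensional P \<and> (\<Sum>B\<in>P. cmod (\<mu> P B) powr q) \<le> c) \<and>
     (\<forall>P\<in>clopen_partitions X. \<forall>Q\<in>clopen_partitions X. refines (topspace X) P Q \<longrightarrow>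
       (\<forall>C\<in>Q. (\<Sum>B\<in>{B\<in>P. B \<subseteq> C}. \<mu> P B) = \<mu> Q C))"
proof -
  have "push P Q (\<mu> P) = \<mu> Q \<longleftrightarrow> (\<forall>C\<in>Q. (\<Sum>B\<in>{B\<in>P. B \<subseteq> C}. \<mu> P B) = \<mu> Q C)"
    if "\<mu> Q \<in> extensional Q" for P Q
    using that by (auto simp: push_def fun_eq_iff extensional_def)
  then show ?thesis
    by (auto simp: Mq_ball_def lq_ball_def PiE_iff)
qed

text \<open>The ball carries the initial topology of its coordinates \<open>\<mu> P B\<close>. All
  later continuity proofs for measures are therefore coordinatewise.\<close>

lemma continuous_map_Mq_ball:
  "continuous_map T (Mq_ball q c X) g \<longleftrightarrow>
     (\<forall>t\<in>topspace T. g t \<in> topspace (Mq_ball q c X)) \<and>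
     (\<forall>P\<in>clopen_partitions X. \<forall>B\<in>P. continuous_map T euclidean (\<lambda>t. g t P B))"
  (is "_ \<longleftrightarrow> ?mem \<and> ?cont")
proof (cases ?mem)
  case True
  then show ?thesis
    unfolding Mq_ball_def lq_ball_def continuous_map_in_subtopology continuous_map_componentwise
    by (auto simp: PiE_iff)
next
  case False
  then show ?thesis
    by (auto simp: continuous_map_def)
qed

text \<open>A larger exponent costs a change of radius from c to \<open>c powr (r / q)\<close>,
  uniformly over all partitions. This makes the balls a directed family.\<close>

lemma continuous_map_Mq_ball_mono:
  assumes "0 < q" "q \<le> r" "c powr (r / q) \<le> d"
  shows "continuous_map (Mq_ball q c X) (Mq_ball r d X) id"
  unfolding continuous_map_Mq_ball
proof (intro conjI ballI)
  fix \<mu> assume \<mu>: "\<mu> \<in> topspace (Mq_ball q c X)"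
  have "(\<Sum>B\<in>P. cmod (\<mu> P B) powr r) \<le> d" if P: "P \<in> clopen_partitions X" for P
    using sum_powr_exponent_mono[of P "\<lambda>B. cmod (\<mu> P B)" q r c] assms P \<mu>
    by (auto simp: mem_topspace_Mq_ball clopen_partitions_def)
  then show "id \<mu> \<in> topspace (Mq_ball r d X)"
    using \<mu> by (simp add: mem_topspace_Mq_ball)
next
  fix P B assume "P \<in> clopen_partitions X" "B \<in> P"
  then show "continuous_map (Mq_ball q c X) euclidean (\<lambda>\<mu>. id \<mu> P B)"
    using continuous_map_Mq_ball[of "Mq_ball q c X" q c X id] by auto
qed

lemma Mq_ball_directed:
  assumes "0 < q" "0 < r" "0 < c"
  obtains d where "0 < d" "continuous_map (Mq_ball q c X) (Mq_ball (max q r) d X) id"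
    "continuous_map (Mq_ball r c' X) (Mq_ball (max q r) d X) id"
proof
  show "0 < max (c powr (max q r / q)) (c' powr (max q r / r))"
    using assms by (simp add: less_max_iff_disj)
qed (use assms in \<open>auto intro!: continuous_map_Mq_ball_mono\<close>)

lemma sections_M_lt_iff:
  "g \<in> sections (M_lt p X) T \<longleftrightarrow> (\<exists>q c. 0 < q \<and> q < p \<and> 0 < c \<and> g \<in> cmaps T (Mq_ball q c X))"
  unfolding M_lt_def by simp (metis greaterThan_iff greaterThanLessThan_iff)

lemma condensed_set_M_lt:
  assumes "uncountable_strong_limit \<kappa>" "0 < p"
  shows "condensed_set \<kappa> (M_lt p X)"
proof (rule condensed_set_Union_cmaps[OF assms(1)])
  let ?\<X> = "\<Union>q\<in>{0<..<p}. \<Union>c\<in>{0<..}. {Mq_ball q c X}"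
  show "sections (M_lt p X) = (\<lambda>T. \<Union>Y\<in>?\<X>. cmaps T Y)"
    by (auto simp: M_lt_def)
  show "pullback (M_lt p X) = (\<lambda>R T h g. compose (topspace R) g h)"
    by (simp add: M_lt_def)
  have "p / 2 \<in> {0<..<p}" "(1::real) \<in> {0<..}" using assms by auto
  then show "?\<X> \<noteq> {}" by blast
  fix Y Z assume "Y \<in> ?\<X>" "Z \<in> ?\<X>"
  then obtain q c r d where *: "0 < q" "q < p" "0 < c" "Y = Mq_ball q c X"
    "0 < r" "r < p" "0 < d" "Z = Mq_ball r d X"
    by auto
  obtain e where "0 < e" "continuous_map Y (Mq_ball (max q r) e X) id"
    "continuous_map Z (Mq_ball (max q r) e X) id"
    using Mq_ball_directed[of q r c X d] * by metis
  moreover have "max q r \<in> {0<..<p}" "e \<in> {0<..}" using * \<open>0 < e\<close> by auto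
  ultimately show "\<exists>W\<in>?\<X>. continuous_map Y W id \<and> continuous_map Z W id"
    by blast
qed

section \<open>Vector space operations on measures\<close>

lemma meas_zero_in_Mq_ball: "0 \<le> c \<Longrightarrow> meas_zero X \<in> topspace (Mq_ball q c X)"
  by (auto simp: mem_topspace_Mq_ball meas_zero_def)

text \<open>Radii simply add because q-th powers are subadditive for q \<le> 1; through this the
  bound p \<le> 1 enters the vector space structure.\<close>

lemma meas_add_in_Mq_ball:
  assumes q: "0 < q" "q \<le> 1"
    and \<mu>: "\<mu> \<in> topspace (Mq_ball q c X)" and \<nu>: "\<nu> \<in> topspace (Mq_ball q d X)"
  shows "meas_add X \<mu> \<nu> \<in> topspace (Mq_ball q (c + d) X)"
proof -
  have "(\<Sum>B\<in>P. cmod (\<mu> P B + \<nu> P B) powr q) \<le> c + d" if P: "P \<in> clopen_partitions X" for P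
  proof -
    have "cmod (\<mu> P B + \<nu> P B) powr q \<le> cmod (\<mu> P B) powr q + cmod (\<nu> P B) powr q" for B
      using order_trans[OF powr_mono2[OF _ _ norm_triangle_ineq] powr_add_le] q by auto
    then have "(\<Sum>B\<in>P. cmod (\<mu> P B + \<nu> P B) powr q)
        \<le> (\<Sum>B\<in>P. cmod (\<mu> P B) powr q) + (\<Sum>B\<in>P. cmod (\<nu> P B) powr q)"
      by (simp add: sum_mono flip: sum.distrib)
    then show ?thesis
      using \<mu> \<nu> P unfolding mem_topspace_Mq_ball by fastforce
  qed
  then show ?thesis
    using \<mu> \<nu> by (auto simp: mem_topspace_Mq_ball meas_add_def sum.distrib)
qed

lemma meas_smult_in_Mq_ball:
  assumes "0 \<le> q" "cmod k \<le> K" and \<mu>: "\<mu> \<in> topspace (Mq_ball q c X)"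
  shows "meas_smult X k \<mu> \<in> topspace (Mq_ball q (K powr q * c) X)"
proof -
  have "(\<Sum>B\<in>P. cmod (k * \<mu> P B) powr q) \<le> K powr q * c" if P: "P \<in> clopen_partitions X" for P
  proof -
    have "(\<Sum>B\<in>P. cmod (k * \<mu> P B) powr q) = cmod k powr q * (\<Sum>B\<in>P. cmod (\<mu> P B) powr q)"
      by (simp add: norm_mult powr_mult sum_distrib_left)
    also have "\<dots> \<le> K powr q * c"
      using assms P by (intro mult_mono powr_mono2 sum_nonneg) (auto simp: mem_topspace_Mq_ball)
    finally show ?thesis .
  qed
  then show ?thesis
    using \<mu> by (auto simp: mem_topspace_Mq_ball meas_smult_def simp flip: sum_distrib_left)
qed

lemma meas_add_zero_left: "\<mu> \<in> topspace (Mq_ball q c X) \<Longrightarrow> meas_add X (meas_zero X) \<mu> = \<mu>"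
  and meas_smult_one: "\<mu> \<in> topspace (Mq_ball q c X) \<Longrightarrow> meas_smult X 1 \<mu> = \<mu>"
  by (auto simp: mem_topspace_Mq_ball meas_add_def meas_zero_def meas_smult_def extensional_def fun_eq_iff)

lemma meas_add_assoc: "meas_add X (meas_add X \<mu> \<nu>) \<xi> = meas_add X \<mu> (meas_add X \<nu> \<xi>)"
  and meas_add_commute: "meas_add X \<mu> \<nu> = meas_add X \<nu> \<mu>"
  and meas_add_neg: "meas_add X (meas_smult X (- 1) \<mu>) \<mu> = meas_zero X"
  and meas_smult_add_left: "meas_smult X (k + l) \<mu> = meas_add X (meas_smult X k \<mu>) (meas_smult X l \<mu>)"
  and meas_smult_add_right:
    "meas_smult X k (meas_add X \<mu> \<nu>) = meas_add X (meas_smult X k \<mu>) (meas_smult X k \<nu>)"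
  and meas_smult_assoc: "meas_smult X (k * l) \<mu> = meas_smult X k (meas_smult X l \<mu>)"
  by (auto simp: meas_add_def meas_smult_def meas_zero_def fun_eq_iff algebra_simps)

lemma zero_sec_in_M_lt:
  assumes "0 < p"
  shows "zero_sec (M_lt p X) T \<in> sections (M_lt p X) T"
  unfolding sections_M_lt_iff
  using assms
  by (intro exI[of _ "p / 2"] exI[of _ 1])
    (auto simp: M_lt_def continuous_map_Mq_ball meas_zero_in_Mq_ball intro!: restrict_in_cmaps)

text \<open>The two sections may be bounded with different exponents and radii. Both are moved into
  one ball, whose radius then doubles.\<close>

lemma add_sec_in_M_lt:
  assumes "p \<le> 1" and x: "x \<in> sections (M_lt p X) T" and y: "y \<in> sections (M_lt p X) T"
  shows "add_sec (M_lt p X) T x y \<in> sections (M_lt p X) T"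
proof -
  obtain q c r d where *: "0 < q" "q < p" "0 < c" "x \<in> cmaps T (Mq_ball q c X)"
    "0 < r" "r < p" "0 < d" "y \<in> cmaps T (Mq_ball r d X)"
    using x y unfolding sections_M_lt_iff by metis
  obtain e where e: "0 < e" "continuous_map (Mq_ball q c X) (Mq_ball (max q r) e X) id"
    "continuous_map (Mq_ball r d X) (Mq_ball (max q r) e X) id"
    using Mq_ball_directed[of q r c X d] * by metis
  then have xy: "x \<in> cmaps T (Mq_ball (max q r) e X)" "y \<in> cmaps T (Mq_ball (max q r) e X)"
    using * cmaps_trans by blast+
  have "continuous_map T (Mq_ball (max q r) (e + e) X) (\<lambda>t. meas_add X (x t) (y t))"
    using * \<open>p \<le> 1\<close> unfolding continuous_map_Mq_ball
  proof (intro conjI ballI)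
    show "meas_add X (x t) (y t) \<in> topspace (Mq_ball (max q r) (e + e) X)" if "t \<in> topspace T" for t
      using that * \<open>p \<le> 1\<close> xy
      by (intro meas_add_in_Mq_ball) (auto simp: cmaps_def continuous_map_Mq_ball)
  qed (use xy in \<open>auto simp: cmaps_def continuous_map_Mq_ball meas_add_def intro!: continuous_intros\<close>)
  then have "add_sec (M_lt p X) T x y \<in> cmaps T (Mq_ball (max q r) (e + e) X)"
    by (auto simp: M_lt_def intro: restrict_in_cmaps)
  then show ?thesis
    unfolding sections_M_lt_iff using * e(1)
    by (intro exI[of _ "max q r"] exI[of _ "e + e"]) auto
qed

text \<open>One radius has to serve all points of T while the scalar varies with the point;
  compactness of T bounds the scalar.\<close>

lemma smult_sec_in_M_lt:
  assumes T: "compact_space T" and k: "k \<in> cmaps T euclidean" and x: "x \<in> sections (M_lt p X) T"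
  shows "smult_sec (M_lt p X) T k x \<in> sections (M_lt p X) T"
proof -
  obtain q c where *: "0 < q" "q < p" "0 < c" "x \<in> cmaps T (Mq_ball q c X)"
    using x unfolding sections_M_lt_iff by metis
  have "compactin euclidean (k ` topspace T)"
    using T k image_compactin unfolding compact_space_def cmaps_def by blast
  then have "bounded (k ` topspace T)" by (simp add: compact_imp_bounded)
  then obtain K where K: "0 < K" "\<And>t. t \<in> topspace T \<Longrightarrow> cmod (k t) \<le> K"
    unfolding bounded_pos by auto
  have "continuous_map T (Mq_ball q (K powr q * c) X) (\<lambda>t. meas_smult X (k t) (x t))"
    using * k K
    by (auto simp: cmaps_def continuous_map_Mq_ball meas_smult_def
        intro!: continuous_map_bilinear[OF bounded_bilinear_mult]
        intro: meas_smult_in_Mq_ball[unfolded meas_smult_def])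
  then have "smult_sec (M_lt p X) T k x \<in> cmaps T (Mq_ball q (K powr q * c) X)"
    by (auto simp: M_lt_def intro: restrict_in_cmaps)
  then show ?thesis
    unfolding sections_M_lt_iff using * K
    by (intro exI[of _ q] exI[of _ "K powr q * c"]) auto
qed

lemma sections_M_ltD:
  assumes "x \<in> sections (M_lt p X) T"
  obtains q c where "0 < q" "q < p" "0 < c" "x \<in> extensional (topspace T)"
    "\<And>t. t \<in> topspace T \<Longrightarrow> x t \<in> topspace (Mq_ball q c X)"
  using assms unfolding sections_M_lt_iff cmaps_def continuous_map_Mq_ball by blast

lemma module_M_lt:
  assumes T: "compact_space T" and p: "0 < p" "p \<le> 1"
  shows "Module.module (cont_ring T) (sec_module (M_lt p X) T)"
proof (intro moduleI abelian_groupI cring_cont_ring)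
  note defs = sec_module_def cont_ring_def M_lt_def
  have carrier: "carrier (sec_module (M_lt p X) T) = sections (M_lt p X) T"
    by (simp add: sec_module_def)
  {
    fix x y assume "x \<in> carrier (sec_module (M_lt p X) T)" "y \<in> carrier (sec_module (M_lt p X) T)"
    then show "x \<oplus>\<^bsub>sec_module (M_lt p X) T\<^esub> y \<in> carrier (sec_module (M_lt p X) T)"
      using add_sec_in_M_lt[OF p(2)] by (simp add: sec_module_def)
    show "x \<oplus>\<^bsub>sec_module (M_lt p X) T\<^esub> y = y \<oplus>\<^bsub>sec_module (M_lt p X) T\<^esub> x"
      by (simp add: defs meas_add_commute)
  next
    show "\<zero>\<^bsub>sec_module (M_lt p X) T\<^esub> \<in> carrier (sec_module (M_lt p X) T)"
      using zero_sec_in_M_lt[OF p(1)] by (simp add: sec_module_def)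
  next
    fix x assume "x \<in> carrier (sec_module (M_lt p X) T)"
    then have x: "x \<in> sections (M_lt p X) T" by (simp add: carrier)
    then obtain q c where xe: "x \<in> extensional (topspace T)"
      "\<And>t. t \<in> topspace T \<Longrightarrow> x t \<in> topspace (Mq_ball q c X)"
      using sections_M_ltD by metis
    show "\<zero>\<^bsub>sec_module (M_lt p X) T\<^esub> \<oplus>\<^bsub>sec_module (M_lt p X) T\<^esub> x = x"
      "\<one>\<^bsub>cont_ring T\<^esub> \<odot>\<^bsub>sec_module (M_lt p X) T\<^esub> x = x"
      using xe meas_add_zero_left[OF xe(2)] meas_smult_one[OF xe(2)]
      by (auto simp: defs intro!: extensionalityI[of _ "topspace T"])
    \<comment> \<open>The negative of a section is its multiple by the constant function -1, so its
      boundedness is already known.\<close>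
    have k: "(\<lambda>t\<in>topspace T. - 1) \<in> cmaps T euclidean"
      by (intro restrict_in_cmaps) simp
    show "\<exists>y\<in>carrier (sec_module (M_lt p X) T).
        y \<oplus>\<^bsub>sec_module (M_lt p X) T\<^esub> x = \<zero>\<^bsub>sec_module (M_lt p X) T\<^esub>"
      using smult_sec_in_M_lt[OF T k x] unfolding carrier
      by (rule bexI[rotated]) (simp add: defs meas_add_neg cong: restrict_cong)
  next
    fix k x assume "k \<in> carrier (cont_ring T)" "x \<in> carrier (sec_module (M_lt p X) T)"
    then show "k \<odot>\<^bsub>sec_module (M_lt p X) T\<^esub> x \<in> carrier (sec_module (M_lt p X) T)"
      using smult_sec_in_M_lt[OF T] by (simp add: sec_module_def cont_ring_def)
  }
qed (simp_all add: sec_module_def cont_ring_def M_lt_def meas_add_assoc meas_smult_add_left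
    meas_smult_add_right meas_smult_assoc cong: restrict_cong)

lemma condensed_vector_space_M_lt:
  assumes \<kappa>: "uncountable_strong_limit \<kappa>" and p: "0 < p" "p \<le> 1"
  shows "condensed_vector_space \<kappa> (M_lt p X)"
  unfolding condensed_vector_space_def
proof (intro conjI ballI condensed_set_M_lt[OF \<kappa> p(1)])
  fix T :: "'a topology" assume "T \<in> site \<kappa>"
  then show "Module.module (cont_ring T) (sec_module (M_lt p X) T)"
    by (intro module_M_lt p) (simp add: site_def profinite_space_def)
next
  fix R T :: "'a topology" and h x assume h: "h \<in> cmaps R T"
  then have "\<And>r. r \<in> topspace R \<Longrightarrow> h r \<in> topspace T"
    by (auto simp: cmaps_def continuous_map_def)
  then show
    "pullback (M_lt p X) R T h (add_sec (M_lt p X) T x y) =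
       add_sec (M_lt p X) R (pullback (M_lt p X) R T h x) (pullback (M_lt p X) R T h y)"
    "pullback (M_lt p X) R T h (smult_sec (M_lt p X) T k x) =
       smult_sec (M_lt p X) R (compose (topspace R) k h) (pullback (M_lt p X) R T h x)" for y k
    by (auto simp: M_lt_def compose_def fun_eq_iff)
qed

section \<open>A Banach space as a condensed vector space\<close>

lemma condensed_banach_simps [simp]:
  "sections condensed_banach = (\<lambda>T. cmaps T (euclidean :: 'w::complex_banach topology))"
  "pullback condensed_banach = (\<lambda>R T h (g :: 'u \<Rightarrow> 'w). compose (topspace R) g h)"
  "zero_sec condensed_banach = (\<lambda>T. \<lambda>t\<in>topspace T. 0 :: 'w)"
  "add_sec condensed_banach = (\<lambda>T x y. \<lambda>t\<in>topspace T. x t + y t :: 'w)"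
  "smult_sec condensed_banach = (\<lambda>T k x. \<lambda>t\<in>topspace T. k t *\<^sub>C x t :: 'w)"
  by (simp_all add: condensed_banach_def presheaf.defs condensed_of_top_def)

lemma condensed_set_condensed_banach:
  assumes "uncountable_strong_limit \<kappa>"
  shows "condensed_set \<kappa> (condensed_banach :: ('u, 'u \<Rightarrow> 'w::complex_banach) mod_presheaf)"
  by (rule condensed_set_Union_cmaps[OF assms, where \<X> = "{euclidean}"]) auto

lemma module_condensed_banach:
  "Module.module (cont_ring T)
    (sec_module (condensed_banach :: ('u, 'u \<Rightarrow> 'w::complex_banach) mod_presheaf) T)"
proof (intro moduleI abelian_groupI cring_cont_ring)
  let ?M = "sec_module (condensed_banach :: ('u, 'u \<Rightarrow> 'w) mod_presheaf) T"
  {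
    fix x y assume "x \<in> carrier ?M" "y \<in> carrier ?M"
    then show "x \<oplus>\<^bsub>?M\<^esub> y \<in> carrier ?M"
      by (auto simp: sec_module_def cmaps_def intro!: continuous_intros)
  next
    fix x assume x: "x \<in> carrier ?M"
    show "\<exists>y\<in>carrier ?M. y \<oplus>\<^bsub>?M\<^esub> x = \<zero>\<^bsub>?M\<^esub>"
      using x by (intro bexI[of _ "\<lambda>t\<in>topspace T. - x t"])
        (auto simp: sec_module_def cmaps_def intro!: continuous_intros)
  next
    fix k x assume "k \<in> carrier (cont_ring T)" "x \<in> carrier ?M"
    then show "k \<odot>\<^bsub>?M\<^esub> x \<in> carrier ?M"
      by (auto simp: sec_module_def cont_ring_def cmaps_def
          intro!: continuous_map_bilinear[OF bounded_bilinear_scaleC])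
  }
qed (auto simp: sec_module_def cont_ring_def cmaps_def extensional_def fun_eq_iff
    scaleC_add_left scaleC_add_right scaleC_scaleC scaleC_one algebra_simps)

lemma condensed_vector_space_condensed_banach:
  assumes \<kappa>: "uncountable_strong_limit \<kappa>"
  shows "condensed_vector_space \<kappa> (condensed_banach :: ('u, 'u \<Rightarrow> 'w::complex_banach) mod_presheaf)"
  unfolding condensed_vector_space_def
proof (intro conjI ballI condensed_set_condensed_banach[OF \<kappa>] module_condensed_banach)
  fix R T :: "'u topology" and h and x :: "'u \<Rightarrow> 'w" assume h: "h \<in> cmaps R T"
  then have "\<And>r. r \<in> topspace R \<Longrightarrow> h r \<in> topspace T"
    by (auto simp: cmaps_def continuous_map_def)
  then show
    "pullback condensed_banach R T h (add_sec condensed_banach T x y) =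
       add_sec condensed_banach R (pullback condensed_banach R T h x) (pullback condensed_banach R T h y)"
    "pullback condensed_banach R T h (smult_sec condensed_banach T k x) =
       smult_sec condensed_banach R (compose (topspace R) k h) (pullback condensed_banach R T h x)" for y k
    by (auto simp: compose_def fun_eq_iff)
qed

section \<open>Clopen partitions and Dirac measures\<close>

lemma clopen_partition_block_unique:
  assumes "P \<in> clopen_partitions X" "B \<in> P" "C \<in> P" "a \<in> B" "a \<in> C"
  shows "B = C"
  using assms partition_onD2 unfolding clopen_partitions_def disjoint_def by blast

lemma clopen_partition_block:
  assumes "P \<in> clopen_partitions X" "a \<in> topspace X"
  obtains B where "B \<in> P" "a \<in> B"
  using assms partition_onD1 unfolding clopen_partitions_def by fastforce

text \<open>The complement of a block is the union of the other blocks, which is open.\<close>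

lemma closedin_clopen_partition:
  assumes P: "P \<in> clopen_partitions X" and B: "B \<in> P"
  shows "closedin X B"
proof -
  have "topspace X = \<Union>P"
    using P unfolding clopen_partitions_def by (blast dest: partition_onD1)
  then have "topspace X - B = \<Union>(P - {B})"
    using clopen_partition_block_unique[OF P B] B by blast
  moreover have "openin X (\<Union>(P - {B}))"
    using P by (auto simp: clopen_partitions_def)
  ultimately show ?thesis
    using P B openin_subset[of X B] by (auto simp: closedin_def clopen_partitions_def)
qed

lemma sum_indicator_blocks:
  fixes f :: "'a set \<Rightarrow> 'b::comm_monoid_add"
  assumes P: "P \<in> clopen_partitions X" and B: "B \<in> P" "a \<in> B" and S: "S \<subseteq> P"
  shows "(\<Sum>C\<in>S. if a \<in> C then f C else 0) = (if B \<in> S then f B else 0)"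
proof -
  have "a \<in> C \<longleftrightarrow> C = B" if "C \<in> S" for C
    using clopen_partition_block_unique[OF P B(1), of C a] that B S by blast
  then have "(\<Sum>C\<in>S. if a \<in> C then f C else 0) = (\<Sum>C\<in>S. if C = B then f C else 0)"
    by (intro sum.cong) auto
  also have "\<dots> = (if B \<in> S then f B else 0)"
    using P S finite_subset by (subst sum.delta) (auto simp: clopen_partitions_def)
  finally show ?thesis .
qed

text \<open>On every partition exactly one block contains the point and carries mass 1, so the l^q
  sum is 1 for every exponent.\<close>

lemma dirac_in_Mq_ball:
  assumes a: "a \<in> topspace X"
  shows "dirac X a \<in> topspace (Mq_ball q 1 X)"
  unfolding mem_topspace_Mq_ball
proof (intro conjI ballI impI)
  show "dirac X a \<in> extensional (clopen_partitions X)" by (simp add: dirac_def)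
next
  fix P assume P: "P \<in> clopen_partitions X"
  then show "dirac X a P \<in> extensional P" by (simp add: dirac_def)
  obtain B where B: "B \<in> P" "a \<in> B" using clopen_partition_block[OF P a] .
  have "(\<Sum>C\<in>P. cmod (dirac X a P C) powr q) = (\<Sum>C\<in>P. if a \<in> C then 1 else 0)"
    using P by (intro sum.cong) (auto simp: dirac_def)
  also have "\<dots> = 1"
    using sum_indicator_blocks[OF P B order_refl, of "\<lambda>_. 1"] B by simp
  finally show "(\<Sum>C\<in>P. cmod (dirac X a P C) powr q) \<le> 1" by simp
next
  fix P Q C
  assume P: "P \<in> clopen_partitions X" and Q: "Q \<in> clopen_partitions X"
    and ref: "refines (topspace X) P Q" and C: "C \<in> Q"
  obtain B where B: "B \<in> P" "a \<in> B" using clopen_partition_block[OF P a] .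
  obtain D where D: "D \<in> Q" "B \<subseteq> D" using ref B by (auto simp: refines_def)
  \<comment> \<open>The block B lies in a single block of Q, so it is contained in C as soon as it
    shares the point a with C.\<close>
  have "B \<subseteq> C \<longleftrightarrow> a \<in> C"
    using clopen_partition_block_unique[OF Q D(1) C, of a] B D by auto
  then show "(\<Sum>B\<in>{B \<in> P. B \<subseteq> C}. dirac X a P B) = dirac X a Q C"
    using sum_indicator_blocks[OF P B, of "{B \<in> P. B \<subseteq> C}" "\<lambda>_. 1 :: complex"] B P Q C
    by (simp add: dirac_def)
qed

text \<open>Each coordinate is the indicator function of a clopen block.\<close>

lemma continuous_map_dirac: "continuous_map X (Mq_ball q 1 X) (dirac X)"
  unfolding continuous_map_Mq_ball
proof (intro conjI ballI dirac_in_Mq_ball)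
  fix P B assume P: "P \<in> clopen_partitions X" and B: "B \<in> P"
  have open_B: "openin X B" using P B by (simp add: clopen_partitions_def)
  have "continuous_map X euclidean (\<lambda>a. if a \<in> B then 1 else 0 :: complex)"
    unfolding continuous_map_def
  proof (intro conjI allI impI)
    fix U :: "complex set"
    have "{a \<in> topspace X. (if a \<in> B then 1 else 0) \<in> U} =
        (if 1 \<in> U then B else {}) \<union> (if 0 \<in> U then topspace X - B else {})"
      using openin_subset[OF open_B] by auto
    then show "openin X {a \<in> topspace X. (if a \<in> B then 1 else 0) \<in> U}"
      using open_B closedin_clopen_partition[OF P B] by (auto simp: closedin_def)
  qed auto
  then show "continuous_map X euclidean (\<lambda>a. dirac X a P B)"
    using P B by (simp add: dirac_def)
qed

lemma dirac_section:
  assumes "0 < p" "T \<in> site \<kappa>" "g \<in> cmaps T X"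
  shows "condensed_of_map \<kappa> X (dirac X) T g \<in> sections (M_lt p X) T"
proof -
  have "compose (topspace T) (dirac X) g \<in> cmaps T (Mq_ball (p / 2) 1 X)"
    using continuous_map_compose[of T X g _ "dirac X", OF _ continuous_map_dirac] assms
    by (auto simp: cmaps_def compose_def o_def)
  then show ?thesis
    unfolding sections_M_lt_iff using assms
    by (intro exI[of _ "p / 2"] exI[of _ 1]) (simp add: condensed_of_map_def)
qed

section \<open>The extension over the compactified natural numbers\<close>

lemma openin_N_infty: "openin N_infty V \<longleftrightarrow> (None \<in> V \<longrightarrow> finite (- V))"
proof (cases "None \<in> V")
  case True
  have "openin N_infty V \<longleftrightarrow> (\<exists>C. finite C \<and> V = insert None (Some ` (- C)))"
    using True by (auto simp: openin_Alexandroff_compactification compactin_discrete_topology Compl_eq_Diff_UNIV)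
  also have "\<dots> \<longleftrightarrow> finite (- V)"
  proof
    assume "\<exists>C. finite C \<and> V = insert None (Some ` (- C))"
    then obtain C where C: "finite C" "V = insert None (Some ` (- C))" by blast
    have "- V \<subseteq> Some ` C"
    proof
      fix x assume "x \<in> - V"
      then show "x \<in> Some ` C" using C by (cases x) auto
    qed
    then show "finite (- V)" using C finite_surj by blast
  next
    assume fin: "finite (- V)"
    have "finite (Some -` (- V))" using fin by (simp add: finite_vimageI)
    moreover have "V = insert None (Some ` (- (Some -` (- V))))"
    proof (rule Set.set_eqI)
      fix x show "x \<in> V \<longleftrightarrow> x \<in> insert None (Some ` (- (Some -` (- V))))"
        using True by (cases x) auto
    qed
    ultimately show "\<exists>C. finite C \<and> V = insert None (Some ` (- C))" by blast
  qed
  finally show ?thesis using True by simp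
next
  case False
  then have "V = Some ` (Some -` V)"
  proof -
    have "x \<in> V \<longleftrightarrow> x \<in> Some ` (Some -` V)" for x using False by (cases x) auto
    then show ?thesis by blast
  qed
  then have "openin N_infty V"
    by (metis openin_Alexandroff_compactification_image_Some openin_discrete_topology subset_UNIV)
  then show ?thesis using False by simp
qed

lemma insert_None_range_Some [simp]: "insert None (range Some) = UNIV"
  by (simp add: UNIV_option_conv)

lemma topspace_N_infty: "topspace N_infty = UNIV"
  by simp

text \<open>A cofinal tower among the finite clopen partitions: it presents the space as a
  sequential limit of finite sets, with one block shrinking to \<infinity>.\<close>

definition initial_blocks :: "nat \<Rightarrow> nat option set set" where
  "initial_blocks N = insert (- Some ` {..<N}) ((\<lambda>n. {Some n}) ` {..<N})"

lemma initial_blocks_clopen: "initial_blocks N \<in> clopen_partitions N_infty"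
proof -
  have "None \<in> - Some ` {..<N}" by auto
  then show ?thesis
    by (auto simp: clopen_partitions_def initial_blocks_def openin_N_infty partition_on_def
        disjoint_def simp del: ComplI)
qed

text \<open>The block of Q that contains \<infinity> is cofinite, so it swallows the last block from
  some stage on; singletons lie in a block of any partition.\<close>

lemma initial_blocks_refines:
  assumes Q: "Q \<in> clopen_partitions N_infty"
  obtains M where "\<And>N. M \<le> N \<Longrightarrow> refines UNIV (initial_blocks N) Q"
proof -
  obtain B where B: "B \<in> Q" "None \<in> B"
    using clopen_partition_block[OF Q, of None] by (metis topspace_N_infty UNIV_I)
  then have "finite (- B)"
    using Q by (auto simp: clopen_partitions_def openin_N_infty)
  then have "finite (Some -` (- B))" by (simp add: finite_vimageI)
  then obtain M where M: "Some -` (- B) \<subseteq> {..<M}"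
    using finite_nat_bounded by blast
  have "refines UNIV (initial_blocks N) Q" if N: "M \<le> N" for N
  proof -
    have "- Some ` {..<N} \<subseteq> B"
    proof
      fix x assume "x \<in> - Some ` {..<N}"
      then show "x \<in> B" using subsetD[OF M] N B by (cases x) fastforce+
    qed
    moreover have "\<exists>C\<in>Q. {Some n} \<subseteq> C" for n
      using clopen_partition_block[OF Q, of "Some n"]
      by (metis topspace_N_infty UNIV_I empty_subsetI insert_subset)
    moreover have "partition_on UNIV (initial_blocks N)" "partition_on UNIV Q"
      using initial_blocks_clopen[of N] Q by (simp_all add: clopen_partitions_def)
    ultimately show ?thesis
      using B by (auto simp: refines_def initial_blocks_def)
  qed
  then show ?thesis using that by blast
qed

lemma initial_blocks_antimono:
  assumes "M \<le> N" shows "refines UNIV (initial_blocks N) (initial_blocks M)"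
proof -
  have "\<exists>C\<in>initial_blocks M. B \<subseteq> C" if B: "B \<in> initial_blocks N" for B
  proof (cases "B = - Some ` {..<N}")
    case True
    then show ?thesis using assms by (force simp: initial_blocks_def)
  next
    case False
    then obtain n where "B = {Some n}" using B unfolding initial_blocks_def by blast
    then show ?thesis
      by (cases "n < M") (force simp: initial_blocks_def)+
  qed
  then show ?thesis
    using initial_blocks_clopen[of N] initial_blocks_clopen[of M]
    by (auto simp: refines_def clopen_partitions_def)
qed

text \<open>\<open>Suc n\<close> is the first level of the tower at which {n} is a block of its own;
  on a ball, every later level gives the same value.\<close>

definition mass :: "nat option meas \<Rightarrow> nat \<Rightarrow> complex" where
  "mass \<mu> n = \<mu> (initial_blocks (Suc n)) {Some n}"

lemma initial_blocks_singleton: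
  assumes \<mu>: "\<mu> \<in> topspace (Mq_ball q c N_infty)" and n: "n < N"
  shows "\<mu> (initial_blocks N) {Some n} = mass \<mu> n"
proof -
  have "refines (topspace N_infty) (initial_blocks N) (initial_blocks (Suc n))"
    using initial_blocks_antimono[of "Suc n" N] n by simp
  moreover have "{Some n} \<in> initial_blocks (Suc n)" by (auto simp: initial_blocks_def)
  ultimately have "(\<Sum>B\<in>{B\<in>initial_blocks N. B \<subseteq> {Some n}}. \<mu> (initial_blocks N) B) = mass \<mu> n"
    using \<mu> initial_blocks_clopen unfolding mem_topspace_Mq_ball mass_def by blast
  moreover have "{B\<in>initial_blocks N. B \<subseteq> {Some n}} = {{Some n}}"
  proof -
    \<comment> \<open>The tail block contains \<infinity> and so is not inside a finite singleton;
      the push-forward sum has one term only.\<close>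
    have "None \<in> - Some ` {..<N}" by auto
    then have "\<not> - Some ` {..<N} \<subseteq> {Some n}" by blast
    then show ?thesis using n by (auto simp: initial_blocks_def)
  qed
  ultimately show ?thesis by simp
qed

text \<open>The first N masses are visible together on the single partition
  \<open>initial_blocks N\<close>, whose bound c does not depend on N. The tail block is
  dropped.\<close>

lemma sum_mass_powr_le:
  assumes \<mu>: "\<mu> \<in> topspace (Mq_ball q c N_infty)"
  shows "(\<Sum>n<N. cmod (mass \<mu> n) powr q) \<le> c"
proof -
  have "(\<Sum>n<N. cmod (mass \<mu> n) powr q) = (\<Sum>n<N. cmod (\<mu> (initial_blocks N) {Some n}) powr q)"
    by (intro sum.cong) (simp_all add: initial_blocks_singleton[OF \<mu>])
  also have "\<dots> = (\<Sum>B\<in>(\<lambda>n. {Some n}) ` {..<N}. cmod (\<mu> (initial_blocks N) B) powr q)"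
    by (subst sum.reindex) (auto simp: inj_on_def)
  also have "\<dots> \<le> (\<Sum>B\<in>initial_blocks N. cmod (\<mu> (initial_blocks N) B) powr q)"
    using initial_blocks_clopen[of N]
    by (intro sum_mono2) (auto simp: clopen_partitions_def initial_blocks_def)
  also have "\<dots> \<le> c"
    using \<mu> initial_blocks_clopen unfolding mem_topspace_Mq_ball by blast
  finally show ?thesis .
qed

lemma
  assumes \<mu>: "\<mu> \<in> topspace (Mq_ball q c N_infty)" and q: "0 < q" "q \<le> 1"
  shows summable_mass: "summable (\<lambda>n. cmod (mass \<mu> n))"
    and suminf_mass_le: "(\<Sum>n. cmod (mass \<mu> n)) \<le> c powr (1 / q)"
proof -
  have "(\<Sum>n<N. cmod (mass \<mu> n)) \<le> c powr (1 / q)" for N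
    using sum_powr_exponent_mono[OF _ _ q sum_mass_powr_le[OF \<mu>], of N] by simp
  then show "summable (\<lambda>n. cmod (mass \<mu> n))" "(\<Sum>n. cmod (mass \<mu> n)) \<le> c powr (1 / q)"
    by (auto intro!: summableI_nonneg_bounded suminf_le_const)
qed

text \<open>There is no term for the mass at \<open>\<infinity>\<close>, so this is the integral of \<open>\<phi>\<close> only when \<open>\<phi> None = 0\<close>.\<close>

definition mass_integral :: "(nat option \<Rightarrow> 'w::complex_banach) \<Rightarrow> nat option meas \<Rightarrow> 'w" where
  "mass_integral \<phi> \<mu> = (\<Sum>n. mass \<mu> n *\<^sub>C \<phi> (Some n))"

section \<open>Convergence, continuity and linearity of the series of masses\<close>

lemma summable_mass_scaleC:
  assumes \<mu>: "\<mu> \<in> topspace (Mq_ball q c N_infty)" and q: "0 < q" "q \<le> 1"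
    and \<phi>: "(\<lambda>n. \<phi> (Some n)) \<longlonglongrightarrow> (0 :: 'w::complex_banach)"
  shows "summable (\<lambda>n. norm (mass \<mu> n *\<^sub>C \<phi> (Some n)))"
proof -
  obtain K where K: "\<And>n. norm (\<phi> (Some n)) \<le> K"
    using convergent_imp_Bseq[OF convergentI[OF \<phi>]] by (auto simp: Bseq_def)
  show ?thesis
  proof (rule summable_comparison_test')
    show "summable (\<lambda>n. cmod (mass \<mu> n) * K)"
      using summable_mass[OF \<mu> q] by (rule summable_mult2)
    show "norm (norm (mass \<mu> n *\<^sub>C \<phi> (Some n))) \<le> cmod (mass \<mu> n) * K" if "0 \<le> n" for n
      by (simp add: norm_scaleC K mult_left_mono)
  qed
qed

text \<open>The tail is at most the l^1 norm of the masses times a bound for \<phi> beyond N, and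
  the l^1 norm is bounded on the whole ball. The error is thus uniform in \<mu>.\<close>

lemma mass_integral_tail:
  assumes \<mu>: "\<mu> \<in> topspace (Mq_ball q c N_infty)" and q: "0 < q" "q \<le> 1"
    and \<phi>: "(\<lambda>n. \<phi> (Some n)) \<longlonglongrightarrow> (0 :: 'w::complex_banach)"
    and e: "\<And>n. N \<le> n \<Longrightarrow> norm (\<phi> (Some n)) \<le> e"
  shows "norm (mass_integral \<phi> \<mu> - (\<Sum>n<N. mass \<mu> n *\<^sub>C \<phi> (Some n))) \<le> c powr (1 / q) * e"
proof -
  let ?f = "\<lambda>n. mass \<mu> n *\<^sub>C \<phi> (Some n)"
  note sf = summable_mass_scaleC[OF \<mu> q \<phi>]
  note sm = summable_mass[OF \<mu> q]
  have e0: "0 \<le> e" using order_trans[OF norm_ge_zero e[OF order_refl]] .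
  have "mass_integral \<phi> \<mu> - (\<Sum>n<N. ?f n) = (\<Sum>n. ?f (n + N))"
    using suminf_minus_initial_segment[OF summable_norm_cancel[OF sf], of N]
    by (simp add: mass_integral_def)
  also have "norm \<dots> \<le> (\<Sum>n. norm (?f (n + N)))"
    using sf by (intro summable_norm) (simp add: summable_iff_shift[of "\<lambda>n. norm (?f n)"])
  also have "\<dots> \<le> (\<Sum>n. cmod (mass \<mu> (n + N)) * e)"
  proof (rule suminf_le)
    show "norm (?f (n + N)) \<le> cmod (mass \<mu> (n + N)) * e" for n
      by (simp add: norm_scaleC e mult_left_mono)
    show "summable (\<lambda>n. norm (?f (n + N)))" using sf summable_iff_shift[of "\<lambda>n. norm (?f n)" N] by simp
    show "summable (\<lambda>n. cmod (mass \<mu> (n + N)) * e)"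
      using sm summable_iff_shift[of "\<lambda>n. cmod (mass \<mu> n)" N] by (intro summable_mult2) simp
  qed
  also have "\<dots> = (\<Sum>n. cmod (mass \<mu> (n + N))) * e"
    using sm summable_iff_shift[of "\<lambda>n. cmod (mass \<mu> n)" N]
    by (intro suminf_mult2[symmetric]) simp
  also have "\<dots> \<le> (\<Sum>n. cmod (mass \<mu> n)) * e"
  proof (rule mult_right_mono[OF _ e0])
    show "(\<Sum>n. cmod (mass \<mu> (n + N))) \<le> (\<Sum>n. cmod (mass \<mu> n))"
      using suminf_split_initial_segment[OF sm, of N] by (simp add: sum_nonneg)
  qed
  also have "\<dots> \<le> c powr (1 / q) * e"
    using suminf_mass_le[OF \<mu> q] e0 by (rule mult_right_mono)
  finally show ?thesis .
qed

lemma continuous_map_mass_integral: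
  assumes q: "0 < q" "q \<le> 1"
    and \<phi>: "(\<lambda>n. \<phi> (Some n)) \<longlonglongrightarrow> (0 :: 'w::complex_banach)"
  shows "continuous_map (Mq_ball q c N_infty) euclidean (mass_integral \<phi>)"
proof -
  let ?S = "\<lambda>N \<mu>. \<Sum>n<N. mass \<mu> n *\<^sub>C \<phi> (Some n)"
  have mass: "continuous_map (Mq_ball q c N_infty) euclidean (\<lambda>\<mu>. mass \<mu> n)" for n
  proof -
    \<comment> \<open>A mass is one of the coordinates that define the topology of the ball.\<close>
    have "{Some n} \<in> initial_blocks (Suc n)" by (auto simp: initial_blocks_def)
    then show ?thesis
      using continuous_map_Mq_ball[of "Mq_ball q c N_infty" q c N_infty id] initial_blocks_clopen
      by (auto simp: mass_def)
  qed
  have "continuous_map (Mq_ball q c N_infty) Met_TC.mtopology (mass_integral \<phi>)"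
  proof (rule Met_TC.continuous_map_uniform_limit[where F = sequentially and f = ?S])
    have "continuous_map (Mq_ball q c N_infty) euclidean (?S N)" for N
      by (intro continuous_map_sum continuous_map_bilinear[OF bounded_bilinear_scaleC] mass) auto
    then show "\<forall>\<^sub>F N in sequentially. continuous_map (Mq_ball q c N_infty) Met_TC.mtopology (?S N)"
      by simp
  next
    fix \<epsilon> :: real assume \<epsilon>: "0 < \<epsilon>"
    \<comment> \<open>The summand 1 keeps the denominator positive when the radius is 0 and makes
      the final estimate strict.\<close>
    define e where "e = \<epsilon> / (c powr (1 / q) + 1)"
    have e: "0 < e" "c powr (1 / q) * e < \<epsilon>"
      using \<epsilon> by (auto simp: e_def field_simps add_pos_nonneg add_nonneg_pos)
    then obtain N0 where N0: "\<And>n. N0 \<le> n \<Longrightarrow> norm (\<phi> (Some n)) \<le> e"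
      using LIMSEQ_D[OF \<phi> e(1)] by force
    have "dist (?S N \<mu>) (mass_integral \<phi> \<mu>) < \<epsilon>"
      if "N0 \<le> N" "\<mu> \<in> topspace (Mq_ball q c N_infty)" for N \<mu>
    proof -
      have "norm (mass_integral \<phi> \<mu> - ?S N \<mu>) \<le> c powr (1 / q) * e"
        by (rule mass_integral_tail) (use that N0 q \<phi> in auto)
      then show ?thesis using e by (simp add: dist_norm norm_minus_commute)
    qed
    then show "\<forall>\<^sub>F N in sequentially. \<forall>\<mu>\<in>topspace (Mq_ball q c N_infty).
        mass_integral \<phi> \<mu> \<in> UNIV \<and> dist (?S N \<mu>) (mass_integral \<phi> \<mu>) < \<epsilon>"
      by (auto simp: eventually_sequentially)
  qed simp
  then show ?thesis by simp
qed

text \<open>At a finite point a single term survives. For the Dirac measure at \<infinity> all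
  masses vanish, so the identity there is exactly the vanishing of \<phi> at \<infinity>.\<close>

lemma mass_integral_dirac:
  assumes "\<phi> None = (0 :: 'w::complex_banach)"
  shows "mass_integral \<phi> (dirac N_infty a) = \<phi> a"
proof -
  have "mass (dirac N_infty a) n = (if a = Some n then 1 else 0)" for n
    using initial_blocks_clopen[of "Suc n"] by (auto simp: mass_def dirac_def initial_blocks_def)
  then have "mass_integral \<phi> (dirac N_infty a) = (\<Sum>n. if a = Some n then \<phi> (Some n) else 0)"
    unfolding mass_integral_def
    by (intro arg_cong[where f = suminf] ext) (simp add: scaleC_one norm_scaleC flip: norm_eq_zero)
  also have "\<dots> = \<phi> a"
  proof (cases a)
    case (Some m)
    then show ?thesis using sums_unique[OF sums_If_finite_set[of "{m}" "\<lambda>n. \<phi> (Some n)"]]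
      by (simp add: eq_commute cong: if_cong)
  qed (use assms in simp)
  finally show ?thesis .
qed

text \<open>The measures may lie in balls with different exponents; each one only has to give a
  convergent series.\<close>

lemma mass_integral_meas_add:
  assumes "\<mu> \<in> topspace (Mq_ball q c N_infty)" "0 < q" "q \<le> 1"
    and "\<nu> \<in> topspace (Mq_ball r d N_infty)" "0 < r" "r \<le> 1"
    and \<phi>: "(\<lambda>n. \<phi> (Some n)) \<longlonglongrightarrow> (0 :: 'w::complex_banach)"
  shows "mass_integral \<phi> (meas_add N_infty \<mu> \<nu>) = mass_integral \<phi> \<mu> + mass_integral \<phi> \<nu>"
proof -
  have "mass (meas_add N_infty \<mu> \<nu>) n = mass \<mu> n + mass \<nu> n" for n
    using initial_blocks_clopen[of "Suc n"] by (auto simp: mass_def meas_add_def initial_blocks_def)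
  then show ?thesis
    unfolding mass_integral_def
    using suminf_add[OF summable_norm_cancel[OF summable_mass_scaleC[OF assms(1-3) \<phi>]]
        summable_norm_cancel[OF summable_mass_scaleC[OF assms(4-6) \<phi>]]]
    by (simp add: scaleC_add_left)
qed

lemma mass_integral_meas_smult:
  assumes "\<mu> \<in> topspace (Mq_ball q c N_infty)" "0 < q" "q \<le> 1"
    and \<phi>: "(\<lambda>n. \<phi> (Some n)) \<longlonglongrightarrow> (0 :: 'w::complex_banach)"
  shows "mass_integral \<phi> (meas_smult N_infty k \<mu>) = k *\<^sub>C mass_integral \<phi> \<mu>"
proof -
  have "mass (meas_smult N_infty k \<mu>) n = k * mass \<mu> n" for n
    using initial_blocks_clopen[of "Suc n"] by (auto simp: mass_def meas_smult_def initial_blocks_def)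
  then show ?thesis
    unfolding mass_integral_def
    using bounded_linear.suminf[OF bounded_linear_scaleC[of k]
      summable_norm_cancel[OF summable_mass_scaleC[OF assms]]]
    by (simp add: scaleC_scaleC)
qed

text \<open>The series is applied pointwise, so naturality is automatic. All three arguments are
  restricted because maps of condensed sets are encoded as extensional families, for which
  uniqueness is literal equality.\<close>

definition mass_extension ::
    "'u rel \<Rightarrow> real \<Rightarrow> (nat option \<Rightarrow> 'w::complex_banach) \<Rightarrow>
      'u topology \<Rightarrow> ('u \<Rightarrow> nat option meas) \<Rightarrow> ('u \<Rightarrow> 'w)" where
  "mass_extension \<kappa> p \<phi> = (\<lambda>T\<in>site \<kappa>. \<lambda>g\<in>sections (M_lt p N_infty) T. \<lambda>t\<in>topspace T.
     mass_integral \<phi> (g t))"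

lemma is_liquid_extension_mass_extension:
  fixes \<phi> :: "nat option \<Rightarrow> 'w::complex_banach"
  assumes \<kappa>: "uncountable_strong_limit (\<kappa> :: 'u rel)" and p: "0 < p" "p \<le> 1"
    and \<phi>: "(\<lambda>n. \<phi> (Some n)) \<longlonglongrightarrow> 0" "\<phi> None = 0"
  shows "is_liquid_extension \<kappa> p N_infty \<phi> (mass_extension \<kappa> p \<phi>)"
  unfolding is_liquid_extension_def condensed_linear_hom_def condensed_hom_def mem_Collect_eq
proof (intro conjI ballI condensed_vector_space_M_lt[OF \<kappa> p] condensed_vector_space_condensed_banach[OF \<kappa>])
  let ?M = "M_lt p N_infty :: ('u, 'u \<Rightarrow> nat option meas) mod_presheaf"
  let ?W = "condensed_banach :: ('u, 'u \<Rightarrow> 'w) mod_presheaf"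
  \<comment> \<open>A section is continuous into one single ball, so continuity of the integral on
    each ball separately is enough.\<close>
  have "(\<lambda>t\<in>topspace T. mass_integral \<phi> (g t)) \<in> cmaps T euclidean"
    if g: "g \<in> sections ?M T" for T :: "'u topology" and g
  proof -
    obtain q c where "0 < q" "q < p" and g': "g \<in> cmaps T (Mq_ball q c N_infty)"
      using g unfolding sections_M_lt_iff by blast
    then have "continuous_map (Mq_ball q c N_infty) euclidean (mass_integral \<phi>)"
      using p \<phi> by (intro continuous_map_mass_integral) auto
    then show ?thesis
      using g' continuous_map_compose[of T _ g euclidean "mass_integral \<phi>"]
      by (auto simp: cmaps_def o_def intro!: restrict_in_cmaps[unfolded cmaps_def])
  qed
  then show "mass_extension \<kappa> p \<phi> \<in> (\<Pi>\<^sub>E T\<in>site \<kappa>. sections ?M T \<rightarrow>\<^sub>E sections ?W T)"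
    by (auto simp: mass_extension_def)
  \<comment> \<open>Additivity and homogeneity are checked at one point t, where some ball with
    exponent at most 1 guarantees convergence of the series.\<close>
  have mem: "\<exists>q c. 0 < q \<and> q \<le> 1 \<and> x t \<in> topspace (Mq_ball q c N_infty)"
    if "x \<in> sections ?M T" "t \<in> topspace T" for x T t
    using that p by (elim sections_M_ltD) force
  {
    fix R T :: "'u topology" and h x
    assume *: "R \<in> site \<kappa>" "T \<in> site \<kappa>" "h \<in> cmaps R T" "x \<in> sections ?M T"
    then have "pullback ?M R T h x \<in> sections ?M R"
      using compose_in_cmaps[OF _ *(3)] unfolding sections_M_lt_iff
      by (fastforce simp: M_lt_def)
    moreover have "\<And>r. r \<in> topspace R \<Longrightarrow> h r \<in> topspace T"
      using * by (auto simp: cmaps_def continuous_map_def)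
    ultimately show "mass_extension \<kappa> p \<phi> R (pullback ?M R T h x) =
        pullback ?W R T h (mass_extension \<kappa> p \<phi> T x)"
      using * by (auto simp: mass_extension_def M_lt_def compose_def fun_eq_iff)
  next
    fix T :: "'u topology" and x y
    assume *: "T \<in> site \<kappa>" "x \<in> sections ?M T" "y \<in> sections ?M T"
    have "mass_integral \<phi> (meas_add N_infty (x t) (y t)) = mass_integral \<phi> (x t) + mass_integral \<phi> (y t)"
      if t: "t \<in> topspace T" for t
      using mem[OF *(2) t] mem[OF *(3) t] mass_integral_meas_add \<phi>(1) by metis
    moreover have "add_sec ?M T x y \<in> sections ?M T"
      using add_sec_in_M_lt[OF p(2)] * by blast
    ultimately show "mass_extension \<kappa> p \<phi> T (add_sec ?M T x y) =
        add_sec ?W T (mass_extension \<kappa> p \<phi> T x) (mass_extension \<kappa> p \<phi> T y)"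
      using * by (auto simp: mass_extension_def M_lt_def fun_eq_iff)
  next
    fix T :: "'u topology" and x and k :: "'u \<Rightarrow> complex"
    assume *: "T \<in> site \<kappa>" "x \<in> sections ?M T" "k \<in> cmaps T euclidean"
    have "mass_integral \<phi> (meas_smult N_infty (k t) (x t)) = k t *\<^sub>C mass_integral \<phi> (x t)"
      if t: "t \<in> topspace T" for t
      using mem[OF *(2) t] mass_integral_meas_smult \<phi>(1) by metis
    moreover have "smult_sec ?M T k x \<in> sections ?M T"
      using smult_sec_in_M_lt * by (auto simp: site_def profinite_space_def)
    ultimately show "mass_extension \<kappa> p \<phi> T (smult_sec ?M T k x) =
        smult_sec ?W T k (mass_extension \<kappa> p \<phi> T x)"
      using * by (auto simp: mass_extension_def M_lt_def fun_eq_iff)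
  next
    fix T :: "'u topology" and g assume *: "T \<in> site \<kappa>" "g \<in> cmaps T N_infty"
    then show "mass_extension \<kappa> p \<phi> T (condensed_of_map \<kappa> N_infty (dirac N_infty) T g) =
        condensed_of_map \<kappa> N_infty \<phi> T g"
      using dirac_section[OF p(1) *]
      by (auto simp: mass_extension_def condensed_of_map_def compose_def fun_eq_iff
          mass_integral_dirac \<phi>(2))
  }
qed

section \<open>Uniqueness of the extension\<close>

text \<open>The measure \<Sum> k i \<cdot> \<delta> at b i. The index set is kept apart from the
  points so that it can be the set of blocks of a partition, with b choosing a point in each
  block.\<close>

definition dirac_combination ::
    "'a topology \<Rightarrow> 'i set \<Rightarrow> ('i \<Rightarrow> complex) \<Rightarrow> ('i \<Rightarrow> 'a) \<Rightarrow> 'a meas" where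
  "dirac_combination X A k b = (\<lambda>P\<in>clopen_partitions X. \<lambda>B\<in>P. \<Sum>i\<in>A. k i * dirac X (b i) P B)"

text \<open>Subadditivity bounds every partition by the l^q sum of the coefficients, even where
  several points share a block. A discretisation therefore stays in the ball of the measure it
  approximates.\<close>

lemma dirac_combination_in_Mq_ball:
  assumes q: "0 < q" "q \<le> 1" and b: "\<And>i. i \<in> A \<Longrightarrow> b i \<in> topspace X"
    and c: "(\<Sum>i\<in>A. cmod (k i) powr q) \<le> c"
  shows "dirac_combination X A k b \<in> topspace (Mq_ball q c X)"
  unfolding mem_topspace_Mq_ball
proof (intro conjI ballI impI)
  show "dirac_combination X A k b \<in> extensional (clopen_partitions X)"
    by (simp add: dirac_combination_def)
next
  fix P assume P: "P \<in> clopen_partitions X"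
  show "dirac_combination X A k b P \<in> extensional P"
    using P by (simp add: dirac_combination_def)
  have "(\<Sum>B\<in>P. cmod (dirac_combination X A k b P B) powr q)
      = (\<Sum>B\<in>P. cmod (\<Sum>i\<in>A. k i * dirac X (b i) P B) powr q)"
    using P by (intro sum.cong) (simp_all add: dirac_combination_def)
  also have "\<dots> \<le> (\<Sum>B\<in>P. \<Sum>i\<in>A. cmod (k i * dirac X (b i) P B) powr q)"
    by (intro sum_mono norm_sum_powr_le q)
  also have "\<dots> = (\<Sum>i\<in>A. cmod (k i) powr q * (\<Sum>B\<in>P. cmod (dirac X (b i) P B) powr q))"
    unfolding sum_distrib_left by (subst sum.swap) (simp add: norm_mult powr_mult)
  also have "\<dots> \<le> (\<Sum>i\<in>A. cmod (k i) powr q * 1)"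
    using dirac_in_Mq_ball[OF b] P unfolding mem_topspace_Mq_ball
    by (intro sum_mono mult_left_mono) auto
  also have "\<dots> \<le> c" using c by simp
  finally show "(\<Sum>B\<in>P. cmod (dirac_combination X A k b P B) powr q) \<le> c" .
next
  fix P Q C
  assume *: "P \<in> clopen_partitions X" "Q \<in> clopen_partitions X" "refines (topspace X) P Q" "C \<in> Q"
  have "(\<Sum>B\<in>{B \<in> P. B \<subseteq> C}. dirac_combination X A k b P B)
      = (\<Sum>B\<in>{B \<in> P. B \<subseteq> C}. \<Sum>i\<in>A. k i * dirac X (b i) P B)"
    using * by (intro sum.cong) (simp_all add: dirac_combination_def)
  also have "\<dots> = (\<Sum>i\<in>A. k i * (\<Sum>B\<in>{B \<in> P. B \<subseteq> C}. dirac X (b i) P B))"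
    unfolding sum_distrib_left by (rule sum.swap)
  also have "\<dots> = (\<Sum>i\<in>A. k i * dirac X (b i) Q C)"
  proof (intro sum.cong refl arg_cong[where f = "(*) (k _)"])
    fix i assume "i \<in> A"
    then show "(\<Sum>B\<in>{B \<in> P. B \<subseteq> C}. dirac X (b i) P B) = dirac X (b i) Q C"
      using dirac_in_Mq_ball[OF b] * unfolding mem_topspace_Mq_ball by blast
  qed
  finally show "(\<Sum>B\<in>{B \<in> P. B \<subseteq> C}. dirac_combination X A k b P B) = dirac_combination X A k b Q C"
    using * by (simp add: dirac_combination_def)
qed

text \<open>The point chosen in a block B of P lies in a block C of Q exactly when B \<subseteq> C.
  The Dirac sum over C is then the push-forward sum, so discretising loses nothing on coarser
  partitions.\<close>

lemma dirac_combination_blocks_eq: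
  assumes P: "P \<in> clopen_partitions X" and Q: "Q \<in> clopen_partitions X"
    and ref: "refines (topspace X) P Q" and b: "\<And>B. B \<in> P \<Longrightarrow> b B \<in> B"
    and \<mu>: "\<mu> \<in> topspace (Mq_ball q c X)"
  shows "dirac_combination X P (\<mu> P) b Q = \<mu> Q"
proof (rule extensionalityI[of _ Q])
  fix C assume C: "C \<in> Q"
  have bC: "b B \<in> C \<longleftrightarrow> B \<subseteq> C" if B: "B \<in> P" for B
  proof -
    obtain D where D: "D \<in> Q" "B \<subseteq> D" using ref B by (auto simp: refines_def)
    then show ?thesis
      using clopen_partition_block_unique[OF Q D(1) C, of "b B"] b[OF B] by auto
  qed
  have fin: "finite P" using P by (simp add: clopen_partitions_def)
  have "dirac_combination X P (\<mu> P) b Q C = (\<Sum>B\<in>P. if B \<subseteq> C then \<mu> P B else 0)"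
    using Q C by (auto simp: dirac_combination_def dirac_def bC intro!: sum.cong)
  also have "\<dots> = (\<Sum>B\<in>{B \<in> P. B \<subseteq> C}. \<mu> P B)"
    using fin by (simp add: sum.inter_filter)
  also have "\<dots> = \<mu> Q C"
    using \<mu> P Q ref C unfolding mem_topspace_Mq_ball by blast
  finally show "dirac_combination X P (\<mu> P) b Q C = \<mu> Q C" .
qed (use Q \<mu> in \<open>auto simp: dirac_combination_def mem_topspace_Mq_ball\<close>)

section \<open>Evaluation of linear maps over the point\<close>

lemma point_in_M_lt:
  assumes "\<mu> \<in> topspace (Mq_ball q c X)" "0 < q" "q < p"
  shows "point \<mu> \<in> sections (M_lt p X) pt"
proof -
  \<comment> \<open>Sections ask for a positive radius, whereas c may be 0, as for the zero
    measure.\<close>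
  have "continuous_map (Mq_ball q c X) (Mq_ball q (max 1 \<bar>c\<bar>) X) id"
    using assms by (intro continuous_map_Mq_ball_mono) auto
  then have "point \<mu> \<in> cmaps pt (Mq_ball q (max 1 \<bar>c\<bar>) X)"
    using point_in_cmaps[OF assms(1)] cmaps_trans by blast
  then show ?thesis
    unfolding sections_M_lt_iff using assms by (intro exI[of _ q] exI[of _ "max 1 \<bar>c\<bar>"]) auto
qed

text \<open>Over the one-point space linear maps are additive and homogeneous in the ordinary sense,
  so induction on the index set reduces to single Dirac measures.\<close>

lemma condensed_linear_hom_eq_dirac_combination:
  fixes \<Phi> \<Psi> :: "'u topology \<Rightarrow> ('u \<Rightarrow> 'a meas) \<Rightarrow> ('u \<Rightarrow> 'w::complex_banach)"
  assumes \<kappa>: "uncountable_strong_limit \<kappa>" and p: "0 < p" "p \<le> 1"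
    and hom: "\<Phi> \<in> condensed_linear_hom \<kappa> (M_lt p X) condensed_banach"
      "\<Psi> \<in> condensed_linear_hom \<kappa> (M_lt p X) condensed_banach"
    and eq: "\<And>a. a \<in> topspace X \<Longrightarrow> \<Phi> pt (point (dirac X a)) = \<Psi> pt (point (dirac X a))"
    and A: "finite A" and b: "\<And>i. i \<in> A \<Longrightarrow> b i \<in> topspace X"
  shows "\<Phi> pt (point (dirac_combination X A k b)) = \<Psi> pt (point (dirac_combination X A k b))"
  using A b
proof (induction A)
  let ?M = "M_lt p X :: ('u, 'u \<Rightarrow> 'a meas) mod_presheaf"
  note pt = pt_in_site[OF \<kappa>]
  have q: "0 < p / 2" "p / 2 < p" "p / 2 \<le> 1" using p by auto
  have k: "point c \<in> cmaps pt euclidean" for c :: complex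
    by (rule point_in_cmaps) simp
  have add: "\<Theta> pt (add_sec ?M pt x y) = (\<lambda>t\<in>{undefined}. \<Theta> pt x t + \<Theta> pt y t)"
    if "\<Theta> \<in> condensed_linear_hom \<kappa> ?M condensed_banach" "x \<in> sections ?M pt" "y \<in> sections ?M pt"
    for \<Theta> :: "'u topology \<Rightarrow> ('u \<Rightarrow> 'a meas) \<Rightarrow> ('u \<Rightarrow> 'w)" and x y
    using that pt by (simp add: condensed_linear_hom_def)
  have smult: "\<Theta> pt (smult_sec ?M pt (point c) x) = (\<lambda>t\<in>{undefined}. c *\<^sub>C \<Theta> pt x t)"
    if "\<Theta> \<in> condensed_linear_hom \<kappa> ?M condensed_banach" "x \<in> sections ?M pt"
    for \<Theta> :: "'u topology \<Rightarrow> ('u \<Rightarrow> 'a meas) \<Rightarrow> ('u \<Rightarrow> 'w)" and c x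
  proof -
    have "\<Theta> pt (smult_sec ?M pt (point c) x) = (\<lambda>t\<in>topspace pt. point c t *\<^sub>C \<Theta> pt x t)"
      using that pt k[of c] unfolding condensed_linear_hom_def condensed_banach_simps by blast
    then show ?thesis by (auto simp: fun_eq_iff)
  qed
  {
    case empty
    \<comment> \<open>Linear maps are only required to respect sums and scalar multiples, so the
      empty combination is treated as the multiple by 0 of the zero measure.\<close>
    have z: "point (dirac_combination X {} k b) = smult_sec ?M pt (point 0) (point (meas_zero X))"
      by (auto simp: dirac_combination_def M_lt_def point_def meas_smult_def fun_eq_iff)
    have "point (meas_zero X) \<in> sections ?M pt"
      using q by (intro point_in_M_lt[where q = "p / 2" and c = 0]) (auto intro: meas_zero_in_Mq_ball)
    then show ?case
      unfolding z using smult[OF hom(1), of _ 0] smult[OF hom(2), of _ 0]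
      by simp
  next
    case (insert i A)
    have d: "point (dirac X (b i)) \<in> sections ?M pt"
      using insert.prems by (intro point_in_M_lt[OF dirac_in_Mq_ball q(1,2)]) auto
    have sd: "smult_sec ?M pt (point (k i)) (point (dirac X (b i))) \<in> sections ?M pt"
      using pt by (intro smult_sec_in_M_lt d k) (simp add: site_def profinite_space_def)
    have dc: "point (dirac_combination X A k b) \<in> sections ?M pt"
      using insert.prems
      by (intro point_in_M_lt[OF dirac_combination_in_Mq_ball[OF q(1,3) _ order_refl] q(1,2)]) auto
    have "point (dirac_combination X (insert i A) k b) =
        add_sec ?M pt (smult_sec ?M pt (point (k i)) (point (dirac X (b i))))
          (point (dirac_combination X A k b))"
      using insert.hyps
      by (auto simp: dirac_combination_def M_lt_def point_def meas_smult_def meas_add_def fun_eq_iff)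
    then show ?case
      using insert.IH insert.prems eq
      by (simp add: add[OF hom(1) sd dc] add[OF hom(2) sd dc] smult[OF hom(1) d] smult[OF hom(2) d])
  }
qed

text \<open>Naturality along the map from the one-point space to t. A linear map into a Banach space
  is thereby determined by its values over the point.\<close>

lemma condensed_linear_hom_at_point:
  fixes \<Phi> :: "'u topology \<Rightarrow> ('u \<Rightarrow> 'a meas) \<Rightarrow> ('u \<Rightarrow> 'w::complex_banach)"
  assumes \<kappa>: "uncountable_strong_limit \<kappa>"
    and hom: "\<Phi> \<in> condensed_linear_hom \<kappa> (M_lt p X) condensed_banach"
    and T: "T \<in> site \<kappa>" "g \<in> sections (M_lt p X) T" "t \<in> topspace T"
  shows "\<Phi> T g t = \<Phi> pt (point (g t)) undefined"
proof -
  have "\<Phi> pt (pullback (M_lt p X) pt T (point t) g) = pullback condensed_banach pt T (point t) (\<Phi> T g)"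
    using hom T pt_in_site[OF \<kappa>] point_in_cmaps[OF T(3)]
    unfolding condensed_linear_hom_def condensed_hom_def by blast
  moreover have "pullback (M_lt p X) pt T (point t) g = point (g t)"
    by (auto simp: M_lt_def compose_def point_def)
  ultimately show ?thesis by (simp add: compose_def)
qed

text \<open>The compactified natural numbers are not a topology on \<open>'u\<close>. Their copy
  lives on the range of an injection into \<open>'u\<close>, with the topology pulled back along its
  left inverse.\<close>

lemma N_infty_in_site:
  assumes \<kappa>: "uncountable_strong_limit (\<kappa> :: 'u rel)"
  obtains Y :: "'u topology" and h where "Y \<in> site \<kappa>" "homeomorphic_map Y N_infty h"
proof -
  obtain e :: "nat option \<Rightarrow> 'u" where e: "inj e"
    using inj_into_strong_limit[OF \<kappa>, of "UNIV :: nat option set"] by auto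
  let ?h = "inv_into UNIV e"
  define Y where "Y = pullback_topology (range e) ?h N_infty"
  have top: "topspace Y = range e"
    by (simp add: Y_def topspace_pullback_topology)
  have "homeomorphic_maps Y N_infty ?h e"
    unfolding homeomorphic_maps_def
  proof (intro conjI ballI)
    show "continuous_map Y N_infty ?h"
      using continuous_map_pullback[OF continuous_map_id, of "range e" ?h N_infty] by (simp add: Y_def o_def)
    show "continuous_map N_infty Y e"
      unfolding Y_def
    proof (rule continuous_map_pullback')
      have "?h \<circ> e = id" using e by (rule inv_o_cancel)
      then show "continuous_map N_infty N_infty (?h \<circ> e)"
        using continuous_map_id by metis
    qed blast
  qed (use e top in auto)
  then have hom: "homeomorphic_map Y N_infty ?h"
    unfolding homeomorphic_map_maps by blast
  then have "Y homeomorphic_space N_infty"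
    using homeomorphic_map_imp_homeomorphic_space by blast
  moreover have "Hausdorff_space N_infty"
    by (simp add: Hausdorff_space_Alexandroff_compactification locally_compact_space_discrete_topology)
  ultimately have "compact_space Y" "Hausdorff_space Y"
    using homeomorphic_compact_space[of Y N_infty] homeomorphic_Hausdorff_space[of Y N_infty] by auto
  moreover have "\<exists>a. C \<subseteq> {a}" if C: "connectedin Y C" for C
  proof -
    have C': "connectedin N_infty (?h ` C)"
      using C hom homeomorphic_imp_continuous_map connectedin_continuous_map_image by blast
    \<comment> \<open>Each finite singleton is clopen, so a connected set lies in it or avoids it; a
      set that avoids all of them contains at most \<infinity>.\<close>
    have "?h ` C \<subseteq> {Some n} \<or> disjnt (?h ` C) {Some n}" for n
      using C' by (rule connectedin_clopen_cases) (auto simp: openin_N_infty closedin_def)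
    then have "\<exists>a. ?h ` C \<subseteq> {a}"
      unfolding disjnt_def by (metis Int_insert_right_if1 insert_not_empty not_None_eq singletonI subsetI)
    then obtain a where "?h ` C \<subseteq> {a}" by blast
    moreover have "C \<subseteq> range e"
      using connectedin_subset_topspace[OF C] top by simp
    ultimately have "C \<subseteq> {e a}"
      by (metis f_inv_into_f image_subset_iff singleton_iff subset_iff)
    then show ?thesis by blast
  qed
  moreover have "|topspace Y| <o \<kappa>"
    unfolding top by (rule countable_ordLess_strong_limit[OF \<kappa>]) simp
  ultimately have "Y \<in> site \<kappa>"
    by (simp add: site_def profinite_space_def)
  then show ?thesis using that hom by blast
qed

text \<open>Uniqueness of limits: the equaliser is closed, so if it missed only \<infinity>, then
  {\<infinity>} would be open and the natural numbers finite.\<close>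

lemma N_infty_continuous_map_eq_at_None:
  assumes F: "continuous_map N_infty Z F" and G: "continuous_map N_infty Z G" and Z: "Hausdorff_space Z"
    and eq: "\<And>n. F (Some n) = G (Some n)"
  shows "F None = G None"
proof (rule ccontr)
  assume "F None \<noteq> G None"
  then have "- {x. F x = G x} = {None}"
    using eq by (auto intro: option.exhaust)
  moreover have "closedin N_infty {x \<in> topspace N_infty. F x = G x}"
    using F G Z by (intro closedin_continuous_maps_eq)
  ultimately have "openin N_infty {None}"
    by (simp add: closedin_def Compl_eq_Diff_UNIV)
  then have "finite (- {None :: nat option})" by (simp add: openin_N_infty)
  moreover have "- {None :: nat option} = range Some" by (auto simp: notin_range_Some)
  ultimately show False by (simp add: finite_image_iff)
qed

text \<open>A measure is the limit of its discretisations along the partitions \<open>P n\<close>, so together they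
  form a section over \<open>\<nat> \<union> {\<infinity>}\<close>. There two linear maps agree at all \<open>n\<close>, hence at \<open>\<infinity>\<close>.\<close>

lemma is_liquid_extension_unique:
  fixes \<Phi> \<Psi> :: "'u topology \<Rightarrow> ('u \<Rightarrow> 'a meas) \<Rightarrow> ('u \<Rightarrow> 'w::complex_banach)"
  assumes \<kappa>: "uncountable_strong_limit \<kappa>" and p: "0 < p" "p \<le> 1"
    and P: "\<And>n. P n \<in> clopen_partitions X"
    and cofinal: "\<And>Q. Q \<in> clopen_partitions X \<Longrightarrow>
      \<forall>\<^sub>F n in sequentially. refines (topspace X) (P n) Q"
    and ext: "is_liquid_extension \<kappa> p X \<phi> \<Phi>" "is_liquid_extension \<kappa> p X \<phi> \<Psi>"
  shows "\<Phi> = \<Psi>"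
proof -
  let ?M = "M_lt p X :: ('u, 'u \<Rightarrow> 'a meas) mod_presheaf"
  let ?W = "condensed_banach :: ('u, 'u \<Rightarrow> 'w) mod_presheaf"
  have hom: "\<Phi> \<in> condensed_linear_hom \<kappa> ?M ?W" "\<Psi> \<in> condensed_linear_hom \<kappa> ?M ?W"
    using ext by (simp_all add: is_liquid_extension_def)
  have eq_dirac: "\<Phi> pt (point (dirac X a)) = \<Psi> pt (point (dirac X a))" if a: "a \<in> topspace X" for a
  proof -
    have "condensed_of_map \<kappa> X (dirac X) pt (point a) = point (dirac X a)"
      using pt_in_site[OF \<kappa>] point_in_cmaps[OF a]
      by (auto simp: condensed_of_map_def compose_def point_def)
    then show ?thesis
      using ext pt_in_site[OF \<kappa>] point_in_cmaps[OF a] unfolding is_liquid_extension_def by metis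
  qed
  have eq_point: "\<Phi> pt (point \<mu>) undefined = \<Psi> pt (point \<mu>) undefined"
    if \<mu>: "\<mu> \<in> topspace (Mq_ball q c X)" and q: "0 < q" "q < p" "0 < c" for \<mu> q c
  proof -
    have "\<exists>x. x \<in> B" if "B \<in> P n" for B n
      using P[of n] that partition_onD3[of "topspace X" "P n"]
      by (auto simp: clopen_partitions_def ex_in_conv)
    then obtain b where b: "\<And>B n. B \<in> P n \<Longrightarrow> b B \<in> B" by metis
    have bX: "b B \<in> topspace X" if "B \<in> P n" for B n
      using b[OF that] P[of n] that openin_subset by (fastforce simp: clopen_partitions_def)
    \<comment> \<open>The approximated measure sits at \<infinity>, its discretisation along P n at
      n. One choice b on blocks serves all partitions.\<close>
    define G where "G = (\<lambda>None \<Rightarrow> \<mu> | Some n \<Rightarrow> dirac_combination X (P n) (\<mu> (P n)) b)"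
    have G_ball: "G x \<in> topspace (Mq_ball q c X)" for x
    proof (cases x)
      case (Some n)
      have "(\<Sum>B\<in>P n. cmod (\<mu> (P n) B) powr q) \<le> c"
        using \<mu> P unfolding mem_topspace_Mq_ball by blast
      then show ?thesis
        using Some q p bX by (auto simp: G_def intro!: dirac_combination_in_Mq_ball)
    qed (simp add: G_def \<mu>)
    have contG: "continuous_map N_infty (Mq_ball q c X) G"
      unfolding continuous_map_Mq_ball
    proof (intro conjI ballI G_ball)
      fix Q C assume Q: "Q \<in> clopen_partitions X" and C: "C \<in> Q"
      obtain M where M: "\<And>n. M \<le> n \<Longrightarrow> refines (topspace X) (P n) Q"
        using cofinal[OF Q] by (auto simp: eventually_sequentially)
      \<comment> \<open>Once P n refines Q the discretisation is exact on Q. Each coordinate of G is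
        thus eventually constant, and a neighbourhood of its value at \<infinity> misses at most the
        indices below M.\<close>
      have tail: "G (Some n) Q C = \<mu> Q C" if "M \<le> n" for n
        using dirac_combination_blocks_eq[OF P Q M[OF that] b \<mu>] by (simp add: G_def)
      show "continuous_map N_infty euclidean (\<lambda>x. G x Q C)"
        unfolding continuous_map_def
      proof (intro conjI allI impI)
        fix U :: "complex set"
        have "- {x. G x Q C \<in> U} \<subseteq> Some ` {..<M}" if U: "G None Q C \<in> U"
        proof
          fix x assume x: "x \<in> - {x. G x Q C \<in> U}"
          then obtain n where "x = Some n" using U by (cases x) auto
          then show "x \<in> Some ` {..<M}" using x that tail[of n] by (force simp: G_def)
        qed
        then show "openin N_infty {x \<in> topspace N_infty. G x Q C \<in> U}"
          using finite_subset by (fastforce simp: openin_N_infty)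
      qed simp
    qed
    \<comment> \<open>Only objects of the site can be inserted into \<Phi> and \<Psi>, so G is
      transported to a homeomorphic copy there.\<close>
    obtain Y :: "'u topology" and h where Y: "Y \<in> site \<kappa>" and h: "homeomorphic_map Y N_infty h"
      by (rule N_infty_in_site[OF \<kappa>])
    obtain h' where h': "homeomorphic_maps Y N_infty h h'"
      using h by (auto simp: homeomorphic_map_maps)
    define g where "g = (\<lambda>y\<in>topspace Y. G (h y))"
    have "g \<in> cmaps Y (Mq_ball q c X)"
      unfolding g_def
      using continuous_map_compose[OF homeomorphic_imp_continuous_map[OF h] contG]
      by (intro restrict_in_cmaps) (simp add: o_def)
    then have g: "g \<in> sections ?M Y"
      using q unfolding sections_M_lt_iff by blast
    have h'Y: "h' x \<in> topspace Y" and hh': "h (h' x) = x" for x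
      using h' by (auto simp: homeomorphic_maps_def continuous_map_def)
    have gh': "g (h' x) = G x" for x
      by (simp add: g_def h'Y hh')
    have cont: "continuous_map N_infty euclidean (\<lambda>x. \<Theta> Y g (h' x))"
      if "\<Theta> \<in> condensed_linear_hom \<kappa> ?M ?W" for \<Theta>
    proof -
      have "\<Theta> Y g \<in> sections ?W Y"
        using that Y g unfolding condensed_linear_hom_def condensed_hom_def by blast
      then show ?thesis
        using h' continuous_map_compose[of N_infty Y h' euclidean "\<Theta> Y g"]
        by (simp add: homeomorphic_maps_def cmaps_def o_def)
    qed
    have "\<Phi> Y g (h' None) = \<Psi> Y g (h' None)"
    proof (rule N_infty_continuous_map_eq_at_None[OF cont[OF hom(1)] cont[OF hom(2)]])
      fix n
      have fin: "finite (P n)" using P[of n] by (simp add: clopen_partitions_def)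
      have "\<Phi> pt (point (G (Some n))) = \<Psi> pt (point (G (Some n)))"
        unfolding G_def option.case
        by (rule condensed_linear_hom_eq_dirac_combination[OF \<kappa> p hom eq_dirac fin bX])
      then show "\<Phi> Y g (h' (Some n)) = \<Psi> Y g (h' (Some n))"
        by (simp add: condensed_linear_hom_at_point[OF \<kappa> hom(1) Y g h'Y]
            condensed_linear_hom_at_point[OF \<kappa> hom(2) Y g h'Y] gh')
    qed simp
    then show ?thesis
      by (simp add: condensed_linear_hom_at_point[OF \<kappa> hom(1) Y g h'Y]
          condensed_linear_hom_at_point[OF \<kappa> hom(2) Y g h'Y] gh' G_def)
  qed
  have PiE: "\<Theta> \<in> (\<Pi>\<^sub>E T\<in>site \<kappa>. sections ?M T \<rightarrow>\<^sub>E cmaps T euclidean)"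
    if "\<Theta> \<in> condensed_linear_hom \<kappa> ?M ?W" for \<Theta>
    using that unfolding condensed_linear_hom_def condensed_hom_def by simp
  show ?thesis
  \<comment> \<open>The families are extensional in the space, the section and the point, so
    agreement at all points gives equality.\<close>
  proof (rule PiE_ext[OF PiE[OF hom(1)] PiE[OF hom(2)]])
    fix T assume T: "T \<in> site \<kappa>"
    show "\<Phi> T = \<Psi> T"
    proof (rule PiE_ext[OF PiE_mem[OF PiE[OF hom(1)] T] PiE_mem[OF PiE[OF hom(2)] T]])
      fix g assume g: "g \<in> sections ?M T"
      obtain q c where "0 < q" "q < p" "0 < c" "\<And>t. t \<in> topspace T \<Longrightarrow> g t \<in> topspace (Mq_ball q c X)"
        using sections_M_ltD[OF g] by metis
      then have "\<Phi> T g t = \<Psi> T g t" if "t \<in> topspace T" for t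
        using that eq_point condensed_linear_hom_at_point[OF \<kappa> _ T g that] hom by metis
      then show "\<Phi> T g = \<Psi> T g"
        using PiE_mem[OF PiE_mem[OF PiE[OF hom(1)] T] g] PiE_mem[OF PiE_mem[OF PiE[OF hom(2)] T] g]
        by (intro cmaps_eqI)
    qed
  qed
qed

lemma ex1_is_liquid_extension_N_infty:
  fixes \<phi> :: "nat option \<Rightarrow> 'w::complex_banach"
  assumes \<kappa>: "uncountable_strong_limit (\<kappa> :: 'u rel)" and p: "0 < p" "p \<le> 1"
    and \<phi>: "(\<lambda>n. \<phi> (Some n)) \<longlonglongrightarrow> 0" "\<phi> None = 0"
  shows "\<exists>!\<Phi>. is_liquid_extension \<kappa> p N_infty \<phi> \<Phi>"
proof (rule ex_ex1I)
  show "\<exists>\<Phi>. is_liquid_extension \<kappa> p N_infty \<phi> \<Phi>"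
    using is_liquid_extension_mass_extension[OF assms] by blast
next
  have cofinal: "\<forall>\<^sub>F n in sequentially. refines (topspace N_infty) (initial_blocks n) Q"
    if Q: "Q \<in> clopen_partitions N_infty" for Q
    using initial_blocks_refines[OF Q] unfolding topspace_N_infty eventually_sequentially by metis
  show "\<Phi> = \<Psi>" if "is_liquid_extension \<kappa> p N_infty \<phi> \<Phi>" "is_liquid_extension \<kappa> p N_infty \<phi> \<Psi>"
    for \<Phi> \<Psi>
    by (rule is_liquid_extension_unique[where P = initial_blocks,
          OF \<kappa> p initial_blocks_clopen cofinal that])
qed

section \<open>The measure of an entire function\<close>

text \<open>The terms of the power series at \<open>z = R\<^sup>2\<close> tend to 0, and their
  moduli are the squares of \<open>cmod (s n) * R ^ n\<close>.\<close>

lemma sqrt_coefficients_decay: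
  fixes a s :: "nat \<Rightarrow> complex"
  assumes sums: "\<And>z. summable (\<lambda>n. a n * z ^ n)" and s: "\<And>n. (s n)\<^sup>2 = a n" and R: "0 \<le> R"
  shows "(\<lambda>n. cmod (s n) * R ^ n) \<longlonglongrightarrow> 0"
proof -
  have "(\<lambda>n. cmod (a n * complex_of_real (R\<^sup>2) ^ n)) \<longlonglongrightarrow> 0"
    using summable_LIMSEQ_zero[OF sums] by (rule tendsto_norm_zero)
  moreover have "cmod (a n * complex_of_real (R\<^sup>2) ^ n) = (cmod (s n) * R ^ n)\<^sup>2" for n
    using R by (simp add: norm_mult norm_power power_mult_distrib flip: s power_mult)
      (simp add: mult.commute)
  ultimately have "(\<lambda>n. sqrt ((cmod (s n) * R ^ n)\<^sup>2)) \<longlonglongrightarrow> sqrt 0"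
    by (intro tendsto_real_sqrt) simp
  then show ?thesis using R by simp
qed

text \<open>The factor \<open>norm 1\<close> accounts for n = 0: on the zero space the identity has
  norm 0 rather than 1.\<close>

lemma norm_power_endo_le:
  fixes T :: "'v::complex_banach endo"
  shows "norm (T ^ n) \<le> norm (1 :: 'v endo) * norm T ^ n"
proof (induction n)
  case (Suc n)
  have "norm (T ^ Suc n) \<le> norm T * norm (T ^ n)" by (simp add: norm_mult_ineq)
  also have "\<dots> \<le> norm T * (norm (1 :: 'v endo) * norm T ^ n)"
    by (rule mult_left_mono[OF Suc]) simp
  finally show ?case by (simp add: mult_ac)
qed simp

text \<open>Decay at R = \<open>norm T\<close> compensates the growth of the powers of T.\<close>

lemma phi_tendsto_zero:
  fixes T :: "'v::complex_banach endo"
  assumes sums: "\<And>z. summable (\<lambda>n. a n * z ^ n)" and s: "\<And>n. (s n)\<^sup>2 = a n"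
  shows "(\<lambda>n. phi s T (Some n)) \<longlonglongrightarrow> 0"
proof (rule Lim_null_comparison)
  have "norm (phi s T (Some n)) \<le> norm (1 :: 'v endo) * (cmod (s n) * norm T ^ n)" for n
    using mult_left_mono[OF norm_power_endo_le[of T n], of "cmod (s n)"]
    by (simp add: phi_def norm_scaleC mult_ac)
  then show "\<forall>\<^sub>F n in sequentially. norm (phi s T (Some n)) \<le> norm (1 :: 'v endo) * (cmod (s n) * norm T ^ n)"
    by simp
  show "(\<lambda>n. norm (1 :: 'v endo) * (cmod (s n) * norm T ^ n)) \<longlonglongrightarrow> 0"
    using tendsto_mult_right_zero[OF sqrt_coefficients_decay[OF assms, of "norm T"]] by simp
qed

text \<open>Decay at R = 2 puts \<open>cmod (s n)\<close> eventually below
  \<open>(1 / 2) ^ n\<close>, hence its q-th power below a geometric series of ratio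
  \<open>(1 / 2) powr q\<close>.\<close>

lemma summable_sqrt_coefficients_powr:
  fixes a s :: "nat \<Rightarrow> complex"
  assumes sums: "\<And>z. summable (\<lambda>n. a n * z ^ n)" and s: "\<And>n. (s n)\<^sup>2 = a n" and q: "0 < q"
  shows "summable (\<lambda>n. cmod (s n) powr q)"
proof (rule summable_comparison_test_ev)
  have "\<forall>\<^sub>F n in sequentially. cmod (s n) * 2 ^ n < 1"
    using order_tendstoD(2)[OF sqrt_coefficients_decay[OF sums s, of 2], of 1] by simp
  then show "\<forall>\<^sub>F n in sequentially. norm (cmod (s n) powr q) \<le> ((1 / 2) powr q) ^ n"
  proof eventually_elim
    case (elim n)
    then have "cmod (s n) \<le> (1 / 2) ^ n" by (simp add: field_simps)
    then have "cmod (s n) powr q \<le> ((1 / 2) ^ n) powr q"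
      using q by (intro powr_mono2) auto
    also have "\<dots> = ((1 / 2) powr q) ^ n"
      by (simp add: powr_powr mult.commute flip: powr_realpow)
    finally show ?case by simp
  qed
  have "(1 / 2) powr q < (1 :: real)"
    using q powr_less_mono2[of q "1 / 2 :: real" 1] by simp
  then show "summable (\<lambda>n. ((1 / 2 :: real) powr q) ^ n)"
    by (intro summable_geometric) simp
qed

text \<open>The finite inequality passes to the limit over finite subsets, as the q-th power is
  continuous on the nonnegative reals for q > 0, including at 0.\<close>

lemma norm_infsum_powr_le:
  fixes m :: "'a \<Rightarrow> 'b::banach"
  assumes q: "0 < q" "q \<le> 1" and m: "(\<lambda>t. norm (m t)) summable_on B"
    and mq: "(\<lambda>t. norm (m t) powr q) summable_on B"
  shows "norm (\<Sum>\<^sub>\<infinity>t\<in>B. m t) powr q \<le> (\<Sum>\<^sub>\<infinity>t\<in>B. norm (m t) powr q)"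
proof -
  have "(m has_sum (\<Sum>\<^sub>\<infinity>t\<in>B. m t)) B"
    by (rule has_sum_infsum[OF abs_summable_summable[OF m]])
  then have "((\<lambda>F. norm (sum m F) powr q) \<longlongrightarrow> norm (\<Sum>\<^sub>\<infinity>t\<in>B. m t) powr q) (finite_subsets_at_top B)"
    unfolding has_sum_def using q by (intro tendsto_powr' tendsto_norm tendsto_const) auto
  then show ?thesis
  proof (rule tendsto_upperbound)
    show "\<forall>\<^sub>F F in finite_subsets_at_top B. norm (sum m F) powr q \<le> (\<Sum>\<^sub>\<infinity>t\<in>B. norm (m t) powr q)"
    proof (rule eventually_finite_subsets_at_top_weakI)
      fix F assume F: "finite F" "F \<subseteq> B"
      have "norm (sum m F) powr q \<le> (\<Sum>t\<in>F. norm (m t) powr q)" by (rule norm_sum_powr_le[OF q])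
      also have "\<dots> \<le> (\<Sum>\<^sub>\<infinity>t\<in>B. norm (m t) powr q)"
        by (rule finite_sum_le_infsum[OF mq F]) simp
      finally show "norm (sum m F) powr q \<le> (\<Sum>\<^sub>\<infinity>t\<in>B. norm (m t) powr q)" .
    qed
  qed simp
qed

section \<open>Measures given by their masses\<close>

lemma infsum_finite_disjoint_Union:
  fixes f :: "'a \<Rightarrow> 'b::banach"
  assumes "finite \<A>" "disjoint \<A>" "\<And>A. A \<in> \<A> \<Longrightarrow> f summable_on A"
  shows "(\<Sum>A\<in>\<A>. \<Sum>\<^sub>\<infinity>t\<in>A. f t) = (\<Sum>\<^sub>\<infinity>t\<in>\<Union>\<A>. f t)"
  using sum_infsum[of \<A> f "\<lambda>A. A"] assms by (simp add: disjoint_def)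

text \<open>Collecting the masses of a block does not increase the l^q sum, and finitely many
  disjoint blocks exhaust the space. The total l^q mass thus bounds all partitions at once.\<close>

lemma meas_of_masses_in_Mq_ball:
  fixes m :: "'a \<Rightarrow> complex"
  assumes q: "0 < q" "q \<le> 1"
    and m: "(\<lambda>t. cmod (m t)) summable_on topspace X"
    and mq: "(\<lambda>t. cmod (m t) powr q) summable_on topspace X"
  shows "meas_of_masses X m \<in> topspace (Mq_ball q (\<Sum>\<^sub>\<infinity>t\<in>topspace X. cmod (m t) powr q) X)"
  unfolding mem_topspace_Mq_ball
proof (intro conjI ballI impI)
  show "meas_of_masses X m \<in> extensional (clopen_partitions X)"
    by (simp add: meas_of_masses_def)
next
  fix P assume P: "P \<in> clopen_partitions X"
  then show "meas_of_masses X m P \<in> extensional P" by (simp add: meas_of_masses_def)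
  have fin: "finite P" and U: "\<Union>P = topspace X" and dis: "disjoint P"
    using P unfolding clopen_partitions_def by (blast dest: partition_onD1 partition_onD2)+
  have "(\<Sum>B\<in>P. cmod (meas_of_masses X m P B) powr q) = (\<Sum>B\<in>P. cmod (\<Sum>\<^sub>\<infinity>t\<in>B. m t) powr q)"
    using P by (intro sum.cong) (simp_all add: meas_of_masses_def)
  also have "\<dots> \<le> (\<Sum>B\<in>P. \<Sum>\<^sub>\<infinity>t\<in>B. cmod (m t) powr q)"
  proof (intro sum_mono norm_infsum_powr_le q)
    fix B assume "B \<in> P"
    then have "B \<subseteq> topspace X" using U by blast
    then show "(\<lambda>t. cmod (m t)) summable_on B" "(\<lambda>t. cmod (m t) powr q) summable_on B"
      using m mq summable_on_subset_banach by blast+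
  qed
  also have "\<dots> = (\<Sum>\<^sub>\<infinity>t\<in>topspace X. cmod (m t) powr q)"
    unfolding U[symmetric]
    by (rule infsum_finite_disjoint_Union[OF fin dis]) (use U mq summable_on_subset_banach in blast)
  finally show "(\<Sum>B\<in>P. cmod (meas_of_masses X m P B) powr q)
      \<le> (\<Sum>\<^sub>\<infinity>t\<in>topspace X. cmod (m t) powr q)" .
next
  fix P Q C
  assume *: "P \<in> clopen_partitions X" "Q \<in> clopen_partitions X" "refines (topspace X) P Q" "C \<in> Q"
  have fin: "finite P" and U: "\<Union>P = topspace X" and dis: "disjoint P"
    using * unfolding clopen_partitions_def by (blast dest: partition_onD1 partition_onD2)+
  \<comment> \<open>The blocks of P inside C cover C: the block of t lies in some block of Q, and
    that block shares t with C.\<close>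
  have "\<exists>B\<in>P. B \<subseteq> C \<and> t \<in> B" if t: "t \<in> C" for t
  proof -
    have "t \<in> topspace X"
      using closedin_clopen_partition[OF *(2,4)] closedin_subset t by blast
    then obtain B where B: "B \<in> P" "t \<in> B" using U by blast
    then obtain D where D: "D \<in> Q" "B \<subseteq> D" using *(3) by (auto simp: refines_def)
    then have "D = C"
      using clopen_partition_block_unique[OF *(2) D(1) *(4)] B t by blast
    then show ?thesis using B D by blast
  qed
  then have C: "\<Union>{B \<in> P. B \<subseteq> C} = C" by blast
  have "(\<Sum>B\<in>{B \<in> P. B \<subseteq> C}. meas_of_masses X m P B) = (\<Sum>B\<in>{B \<in> P. B \<subseteq> C}. \<Sum>\<^sub>\<infinity>t\<in>B. m t)"
    using * by (intro sum.cong) (simp_all add: meas_of_masses_def)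
  also have "\<dots> = (\<Sum>\<^sub>\<infinity>t\<in>\<Union>{B \<in> P. B \<subseteq> C}. m t)"
  proof (rule infsum_finite_disjoint_Union)
    show "disjoint {B \<in> P. B \<subseteq> C}" using dis by (simp add: disjoint_def)
    show "m summable_on B" if "B \<in> {B \<in> P. B \<subseteq> C}" for B
    proof -
      have "B \<subseteq> topspace X" using that U by blast
      then show ?thesis
        by (rule summable_on_subset_banach[OF abs_summable_summable[OF m]])
    qed
  qed (use fin in simp)
  finally show "(\<Sum>B\<in>{B \<in> P. B \<subseteq> C}. meas_of_masses X m P B) = meas_of_masses X m Q C"
    using * by (simp add: C meas_of_masses_def)
qed

lemma summable_on_option_iff:
  fixes f :: "'a option \<Rightarrow> real"
  shows "f summable_on UNIV \<longleftrightarrow> (\<lambda>x. f (Some x)) summable_on UNIV"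
proof -
  have "f summable_on insert None (range Some) \<longleftrightarrow> f summable_on range Some"
    by (rule summable_on_insert_iff)
  then show ?thesis by (simp add: summable_on_reindex o_def)
qed

lemma mu_in_Mq_ball:
  assumes q: "0 < q" "q \<le> 1" and s: "summable (\<lambda>n. cmod (s n) powr q)"
    and s1: "summable (\<lambda>n. cmod (s n))"
  obtains c where "mu s \<in> topspace (Mq_ball q c N_infty)"
proof -
  let ?m = "\<lambda>None \<Rightarrow> 0 | Some n \<Rightarrow> s n"
  have "(\<lambda>t. cmod (?m t)) summable_on topspace N_infty"
    unfolding topspace_N_infty summable_on_option_iff option.case
    using s1 by (intro norm_summable_imp_summable_on) simp
  moreover have "(\<lambda>t. cmod (?m t) powr q) summable_on topspace N_infty"
    unfolding topspace_N_infty summable_on_option_iff option.case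
    using s by (intro norm_summable_imp_summable_on) simp
  ultimately show ?thesis
    using that meas_of_masses_in_Mq_ball[OF q] unfolding mu_def by blast
qed

lemma mass_mu: "mass (mu s) n = s n"
  using initial_blocks_clopen[of "Suc n"]
  by (simp add: mass_def mu_def meas_of_masses_def initial_blocks_def)

text \<open>The first conjunct gives meaning to the definite description in
  \<open>liquid_extension\<close>, and the second makes \<open>mu s\<close> a legitimate point of
  evaluation. Convergence in the third is in the operator norm.\<close>

theorem corollary5p8:
  fixes \<kappa> :: "'u rel" and p :: real and T :: "'v::complex_banach endo"
    and f :: "complex \<Rightarrow> complex" and a s :: "nat \<Rightarrow> complex"
  assumes "uncountable_strong_limit \<kappa>"
    and "0 < p" and "p \<le> 1"
    and "f holomorphic_on UNIV" and "\<And>z. (\<lambda>n. a n * z ^ n) sums f z"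
    and "\<And>n. (s n)\<^sup>2 = a n"
  shows "(\<exists>!\<Phi>. is_liquid_extension \<kappa> p N_infty (phi s T) \<Phi>) \<and>
    mu s \<in> underlying_set (M_lt p N_infty :: ('u, 'u \<Rightarrow> nat option meas) mod_presheaf) \<and>
    (\<lambda>n. a n *\<^sub>C T ^ n) sums eval_point (liquid_extension \<kappa> p N_infty (phi s T)) (mu s)"
proof (intro conjI)
  note \<kappa> = assms(1) and p = assms(2,3)
  have sums: "summable (\<lambda>n. a n * z ^ n)" for z
    using assms(5) by (rule sums_summable)
  note \<phi> = phi_tendsto_zero[OF sums assms(6), of T]
  have phi_None: "phi s T None = 0" by (simp add: phi_def)
  show ex1: "\<exists>!\<Phi>. is_liquid_extension \<kappa> p N_infty (phi s T) \<Phi>"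
    by (rule ex1_is_liquid_extension_N_infty[where ?\<phi> = "phi s T", OF \<kappa> p \<phi> phi_None])
  \<comment> \<open>Uniqueness identifies the abstract extension with the explicit series, which can
    be evaluated.\<close>
  then have ext: "liquid_extension \<kappa> p N_infty (phi s T) = mass_extension \<kappa> p (phi s T)"
    unfolding liquid_extension_def
    by (rule the1_equality) (rule is_liquid_extension_mass_extension[where ?\<phi> = "phi s T", OF \<kappa> p \<phi> phi_None])
  \<comment> \<open>A concrete exponent strictly below p that is also at most 1.\<close>
  have q: "0 < p / 2" "p / 2 \<le> 1" "p / 2 < p" using p by auto
  \<comment> \<open>Exponent 1: the unordered sums that define the measure on blocks rest on
    absolute summability.\<close>
  have "summable (\<lambda>n. cmod (s n))"
    using summable_sqrt_coefficients_powr[OF sums assms(6), of 1] by simp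
  then obtain c where c: "mu s \<in> topspace (Mq_ball (p / 2) c N_infty)"
    using mu_in_Mq_ball[OF q(1,2) summable_sqrt_coefficients_powr[OF sums assms(6) q(1)]] by blast
  have sec: "point (mu s) \<in> sections (M_lt p N_infty :: ('u, 'u \<Rightarrow> nat option meas) mod_presheaf) pt"
    using c q(1,3) by (rule point_in_M_lt)
  then show "mu s \<in> underlying_set (M_lt p N_infty :: ('u, 'u \<Rightarrow> nat option meas) mod_presheaf)"
    by (simp add: underlying_set_def)
  have "(\<lambda>n. mass (mu s) n *\<^sub>C phi s T (Some n)) sums mass_integral (phi s T) (mu s)"
    unfolding mass_integral_def
    by (rule summable_sums[OF summable_norm_cancel[OF summable_mass_scaleC[OF c q(1,2) \<phi>]]])
  moreover have "mass (mu s) n *\<^sub>C phi s T (Some n) = a n *\<^sub>C T ^ n" for n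
    by (simp add: mass_mu phi_def scaleC_scaleC power2_eq_square flip: assms(6))
  ultimately show "(\<lambda>n. a n *\<^sub>C T ^ n) sums eval_point (liquid_extension \<kappa> p N_infty (phi s T)) (mu s)"
    unfolding ext using sec pt_in_site[OF \<kappa>] by (simp add: eval_point_def mass_extension_def)
qed

end
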